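(* If $\lambda>\frac{e^{-1}}{V}\left(1-\frac{\gamma^2}{V^2}\right)$, then there exists $u>0$ such that, for all solutions $t\mapsto z(t)$ of the differential equation $$z'(t)=F(\phi(z(t)))$$ with the initial condition in $C_u$, $$\lim_{t\to+\infty}\phi(z(t))=\mathbf 1/V.$$ If $\lambda<\frac{e^{-1}}{V}\left(1-\frac{\gamma^2}{V^2}\right)$, then the diagonal $\Delta$ is locally unstable.
   Context: $\lambda>0$ is a constant. $\mathcal G$ is a connected undirected graph on the vertex set $\{1,\dots,K\}$ in which every closed neighbourhood $V_i=\{i\}\cup\{j: j\text{ adjacent to }i\}$ has the same cardinality $V$. $A$ is the symmetric $K\times K$ matrix with $A_{ij}=1$ if $j\in V_i$ and $A_{ij}=0$ otherwise (adjacency matrix with ones on the diagonal); its eigenvalues are $\nu_1\le\dots\le\nu_K$, with $\nu_K=V$, and $\gamma=\min_{i<K}(\nu_K-\nu_i)=\nu_K-\nu_{K-1}$ is the spectral gap. $H=\{x\in\mathbb R^K:x_i>0\text{ for all }i\}$; $\mathbf 1=(1,\dots,1)$; $|x|=\sum_k|x_k|$; $\Delta=\{x\in H:x_1=\dots=x_K\}$ is the main diagonal; $C_u=\{x\in H:\bigl|x/|x|-\mathbf 1/K\bigr|\le u\}$ for $u>0$. For $x\in H$, $\phi_i(x)=x_i/\sum_{j\in V_i}x_j$, $\phi=(\phi_1,\dots,\phi_K)$, and $F_i(x)=\lambda-x_ie^{-\sum_{j\in V_i}x_j}$, $F=(F_1,\dots,F_K)$. The differential equation is considered for $z(t)$ in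 $H$. "The diagonal is locally unstable" means: there is $u>0$ such that for every $\delta>0$ there is a solution of $z'=F(\phi(z))$ in $H$ with $z(0)\in C_\delta$ which leaves $C_u$ at some time; equivalently, $\mathbf 1/K$ is an unstable (in Lyapunov's sense) equilibrium of the equation $y'=D\psi(y)F(\phi(y))$ on $\{y\in H:\sum_iy_i=1\}$ describing, up to a time change, the direction $\psi(z)=z/|z|$, where $D\psi(y)$ is the differential of $\psi$ at $y$. *)

theory Defs
  imports "HOL-Analysis.Analysis" "HOL-Computational_Algebra.Computational_Algebra"
begin

definition nbhd :: "('n \<Rightarrow> 'n \<Rightarrow> bool) \<Rightarrow> 'n \<Rightarrow> 'n set" where
  "nbhd E i = insert i {j. E i j}"

definition nbhd_matrix :: "('n::finite \<Rightarrow> 'n \<Rightarrow> bool) \<Rightarrow> real ^ 'n ^ 'n" where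
  "nbhd_matrix E = (\<chi> i j. if j \<in> nbhd E i then 1 else 0)"

definition charpoly :: "real ^ 'n ^ 'n \<Rightarrow> real poly" where
  "charpoly A = det (mat [:0, 1:] - (\<chi> i j. [:A $ i $ j:]))"

text \<open>Real eigenvalues with algebraic multiplicity, in increasing order. For a symmetric matrix
  the list has full length \<open>CARD('n)\<close>. Lists are indexed from 0, so \<open>eigvals A ! (i - 1)\<close> is the
  eigenvalue usually written \<open>\<nu>\<^sub>i\<close>.\<close>

definition eigvals :: "real ^ 'n ^ 'n \<Rightarrow> real list" where
  "eigvals A = sorted_list_of_multiset (proots (charpoly A))"

text \<open>The minimum ranges over a nonempty set only if \<open>CARD('n) \<ge> 2\<close>.\<close>

definition spectral_gap :: "real ^ 'n ^ 'n \<Rightarrow> real" where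
  "spectral_gap A =
     Min ((\<lambda>i. eigvals A ! (CARD('n) - 1) - eigvals A ! i) ` {..<CARD('n) - 1})"

definition H :: "(real ^ 'n) set" where
  "H = {x. \<forall>i. x $ i > 0}"

definition l1norm :: "real ^ 'n \<Rightarrow> real" where
  "l1norm x = (\<Sum>k\<in>UNIV. \<bar>x $ k\<bar>)"

definition diag_cone :: "real \<Rightarrow> (real ^ 'n) set" where
  "diag_cone u = {x \<in> H. l1norm (x /\<^sub>R l1norm x - (\<chi> i. 1 / real CARD('n))) \<le> u}"

definition phi :: "('n::finite \<Rightarrow> 'n \<Rightarrow> bool) \<Rightarrow> real ^ 'n \<Rightarrow> real ^ 'n" where
  "phi E x = (\<chi> i. x $ i / (\<Sum>j\<in>nbhd E i. x $ j))"

definition F :: "real \<Rightarrow> ('n::finite \<Rightarrow> 'n \<Rightarrow> bool) \<Rightarrow> real ^ 'n \<Rightarrow> real ^ 'n" where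
  "F lam E x = (\<chi> i. lam - x $ i * exp (- (\<Sum>j\<in>nbhd E i. x $ j)))"

definition solution_on ::
    "real \<Rightarrow> ('n::finite \<Rightarrow> 'n \<Rightarrow> bool) \<Rightarrow> real set \<Rightarrow> (real \<Rightarrow> real ^ 'n) \<Rightarrow> bool" where
  "solution_on lam E I z \<longleftrightarrow>
     (\<forall>t\<in>I. z t \<in> H \<and> (z has_vector_derivative F lam E (phi E (z t))) (at t within I))"

text \<open>On the diagonal the field equals \<open>lam - exp (-1) / V\<close> in every coordinate. When this is
  negative, solutions started on the diagonal reach the origin, hence leave \<open>H\<close>, in finite
  time, so maximal solutions with a finite lifetime have to be taken into account.\<close>

definition finite_maximal_solution ::
    "real \<Rightarrow> ('n::finite \<Rightarrow> 'n \<Rightarrow> bool) \<Rightarrow> real \<Rightarrow> (real \<Rightarrow> real ^ 'n) \<Rightarrow> bool" where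
  "finite_maximal_solution lam E T z \<longleftrightarrow>
     T > 0 \<and> solution_on lam E {0..<T} z \<and>
     \<not> (\<exists>T'>T. \<exists>w. solution_on lam E {0..<T'} w \<and> (\<forall>t\<in>{0..<T}. w t = z t))"

definition diagonal_locally_unstable :: "real \<Rightarrow> ('n::finite \<Rightarrow> 'n \<Rightarrow> bool) \<Rightarrow> bool" where
  "diagonal_locally_unstable lam E \<longleftrightarrow>
     (\<exists>u>0. \<forall>\<delta>>0. \<exists>T>0. \<exists>z. solution_on lam E {0..<T} z \<and> z 0 \<in> diag_cone \<delta> \<and>
        (\<exists>t\<in>{0..<T}. z t \<notin> diag_cone u))"

end

theory Submission
  imports Defs
begin

text \<open>
  Write a solution as \<open>z = r (1 + \<epsilon>)\<close> with \<open>r\<close> the mean of \<open>z\<close>, so that \<open>\<epsilon>\<close> has mean zero.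
  The field \<open>G = F \<circ> \<phi>\<close> is homogeneous of degree 0, hence \<open>r' = mean (G (1 + \<epsilon>))\<close> and
  \<open>r \<epsilon>' = P \<epsilon>\<close> with \<open>P \<epsilon> = G (1 + \<epsilon>) - mean (G (1 + \<epsilon>)) (1 + \<epsilon>)\<close>. With the graph Laplacian
  \<open>L = V I - A\<close>, the differential of \<open>P\<close> at 0 is \<open>- (c + k L\<^sup>2)\<close> on vectors of mean zero, where
  \<open>c = \<lambda> - exp (-1) / V\<close> and \<open>k = exp (-1) / V\<^sup>3\<close>. The eigenvalues of \<open>L\<close> there are at least
  \<open>\<gamma>\<close>, and \<open>\<gamma>\<close> is one of them, so the sign of \<open>\<mu> = c + k \<gamma>\<^sup>2\<close> decides.

  If \<open>\<mu> > 0\<close>, then \<open>N = |\<epsilon>|\<^sup>2\<close> satisfies \<open>N' \<le> - \<mu> N / r\<close> near the diagonal. For a solution on the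
  half-line, \<open>r\<close> grows at most linearly, so \<open>\<integral> 1 / r = \<infinity>\<close> and \<open>N \<rightarrow> 0\<close>. A maximal solution with finite
  lifetime has a limit, which must be the origin as the solution could be continued otherwise; then
  \<open>r \<rightarrow> 0\<close>, and \<open>N\<close> is bounded by a positive power of \<open>r\<close>.

  If \<open>\<mu> < 0\<close>, choose \<open>p > \<gamma>\<close> so close to \<open>\<gamma>\<close> that \<open>\<sigma> = - c - k p\<^sup>2 > 0\<close> and \<open>p\<^sup>2 - L\<^sup>2\<close> is
  injective on vectors of mean zero. Then \<open>Q = p\<^sup>2 |\<epsilon>|\<^sup>2 - |L \<epsilon>|\<^sup>2\<close> is a Chetaev function: \<open>r Q' \<ge> 2 \<sigma> Q\<close> near the
  diagonal. As \<open>r' \<ge> -1\<close>, the product of \<open>Q\<close> with \<open>r\<close> to the power \<open>2 \<sigma>\<close> increases, so \<open>r\<close> stays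
  bounded below as long as the solution stays near the diagonal, whereas \<open>r' \<le> c / 2 < 0\<close> there.
\<close>

no_notation fps_nth (infixl "$" 75)

section \<open>Ordinary differential equations\<close>

lemma integral_has_vector_derivative_atLeast:
  fixes g :: "real \<Rightarrow> 'a::banach"
  assumes "continuous_on {a..} g" "a \<le> t"
  shows "((\<lambda>t. integral {a..t} g) has_vector_derivative g t) (at t within {a..})"
proof -
  have "((\<lambda>t. integral {a..t} g) has_vector_derivative g t) (at t within {a..t+1})"
    using assms by (intro integral_has_vector_derivative)
      (auto intro: continuous_on_subset)
  moreover have "at t within {a..t+1} = at t within {a..}"
    by (rule at_within_nhd[of _ "{..<t+1}"]) auto
  ultimately show ?thesis by simp
qed

text \<open>Picard--Lindelof in the norm \<open>sup exp (-a t) |x t|\<close>, for which the integral operator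
  contracts on the whole half-line at once.\<close>

lemma lipschitz_ode_solution:
  fixes f :: "'a::banach \<Rightarrow> 'a"
  assumes lip: "L-lipschitz_on UNIV f" and bdd: "\<And>y. norm (f y) \<le> B"
  obtains x where "x 0 = x0"
    "\<And>t. t \<ge> 0 \<Longrightarrow> (x has_vector_derivative f (x t)) (at t within {0..})"
proof -
  \<comment> \<open>The operator contracts with constant \<open>L / a\<close>; this choice makes it
    at most 1/2 and keeps \<open>a\<close> positive even for \<open>L = 0\<close>.\<close>
  define a where "a = 2 * (L + 1)"
  have L: "L \<ge> 0" and a: "a > 0" and La: "L / a \<le> 1/2"
    using lipschitz_on_nonneg[OF lip] by (auto simp: a_def field_simps)
  have B: "B \<ge> 0" using bdd[of 0] norm_ge_zero order_trans by blast
  have contf: "continuous_on UNIV f"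
    by (rule lipschitz_on_continuous_on[OF lip])
  define g where "g u s = f (exp (a * s) *\<^sub>R apply_bcontfun u s)" for u s
  define I where "I u t = integral {0..t} (g u)" for u t
  \<comment> \<open>The unknown is the rescaled function
    \<open>u t = exp (- a * t) *\<^sub>R x t\<close>, which is bounded because \<open>f\<close> is.
    Bounded continuous functions live on the whole line, hence the freezing at time 0 by
    \<open>max 0 t\<close>.\<close>
  define \<Phi> where "\<Phi> u t = exp (- a * max 0 t) *\<^sub>R (x0 + I u (max 0 t))" for u t
  have contg: "continuous_on S (g u)" for u S
  proof -
    have "continuous_on S (\<lambda>s. exp (a * s) *\<^sub>R apply_bcontfun u s)"
      by (auto intro!: continuous_intros)
    then have "continuous_on S (f \<circ> (\<lambda>s. exp (a * s) *\<^sub>R apply_bcontfun u s))"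
      by (rule continuous_on_compose) (rule continuous_on_subset[OF contf], simp)
    then show ?thesis by (simp add: g_def o_def cong: continuous_on_cong)
  qed
  have derI: "(I u has_vector_derivative g u t) (at t within {0..})" if "t \<ge> 0" for u t
    unfolding I_def using integral_has_vector_derivative_atLeast[OF contg that] .
  have contI: "continuous_on {0..} (I u)" for u
    using derI by (intro continuous_on_vector_derivative) auto
  have cont\<Phi>: "continuous_on UNIV (\<Phi> u)" for u
  proof -
    have "continuous_on UNIV (I u \<circ> max 0)"
      by (rule continuous_on_compose) (auto intro!: continuous_intros continuous_on_subset[OF contI])
    then show ?thesis
      unfolding \<Phi>_def by (auto simp: o_def intro!: continuous_intros)
  qed
  have bound\<Phi>: "norm (\<Phi> u t) \<le> norm x0 + B / a" for u t
  proof -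
    define T where "T = max 0 t"
    have T: "T \<ge> 0" by (simp add: T_def)
    have I: "norm (I u T) \<le> B * T"
      using integral_bound[OF T contg, of u B] bdd by (simp add: I_def g_def)
    have "a * T \<le> exp (a * T)"
      using exp_ge_add_one_self[of "a * T"] by linarith
    then have e: "exp (- a * T) * T \<le> 1 / a"
      using a by (simp add: exp_minus field_simps)
    have "norm (\<Phi> u t) = exp (- a * T) * norm (x0 + I u T)"
      by (simp add: \<Phi>_def T_def)
    also have "\<dots> \<le> exp (- a * T) * (norm x0 + B * T)"
      using norm_triangle_ineq[of x0 "I u T"] I by (intro mult_left_mono) auto
    also have "\<dots> = exp (- a * T) * norm x0 + B * (exp (- a * T) * T)"
      by (simp add: algebra_simps)
    also have "\<dots> \<le> 1 * norm x0 + B * (1 / a)"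
      using a T B e by (intro add_mono mult_mono) auto
    finally show ?thesis by simp
  qed
  have in\<Phi>: "\<Phi> u \<in> bcontfun" for u
    using bcontfun_normI[OF cont\<Phi> bound\<Phi>] .
  define \<Psi> where "\<Psi> u = Bcontfun (\<Phi> u)" for u
  have \<Psi>: "apply_bcontfun (\<Psi> u) = \<Phi> u" for u
    by (simp add: \<Psi>_def Bcontfun_inverse in\<Phi>)
  have contr: "dist (\<Psi> u) (\<Psi> v) \<le> 1/2 * dist u v" for u v
  proof (rule dist_bound)
    fix t :: real
    define T where "T = max 0 t"
    have T: "T \<ge> 0" by (simp add: T_def)
    have hi: "((\<lambda>s. L * dist u v * exp (a * s)) has_integral
                 L * dist u v * exp (a * T) / a - L * dist u v * exp (a * 0) / a) {0..T}"
      using a T by (intro fundamental_theorem_of_calculus)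
        (auto intro!: derivative_eq_intros
              simp: has_real_derivative_iff_has_vector_derivative[symmetric])
    have "I u T - I v T = integral {0..T} (\<lambda>s. g u s - g v s)"
      unfolding I_def by (rule integral_diff[symmetric]) (auto intro!: integrable_continuous_real contg)
    also have "norm \<dots> \<le> integral {0..T} (\<lambda>s. L * dist u v * exp (a * s))"
    proof (rule integral_norm_bound_integral)
      fix s assume "s \<in> {0..T}"
      have "norm (g u s - g v s) \<le> L * norm (exp (a * s) *\<^sub>R u s - exp (a * s) *\<^sub>R v s)"
        unfolding g_def using lipschitz_on_normD[OF lip] by simp
      also have "\<dots> = L * exp (a * s) * dist (u s) (v s)"
        by (simp add: dist_norm flip: scaleR_diff_right)
      also have "\<dots> \<le> L * exp (a * s) * dist u v"
        using L dist_bounded[of u s v] by (intro mult_left_mono) auto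
      finally show "norm (g u s - g v s) \<le> L * dist u v * exp (a * s)"
        by (simp add: ac_simps)
    qed (use hi in \<open>auto intro!: integrable_continuous_real continuous_intros contg simp: integrable_on_def\<close>)
    also have "\<dots> = L / a * dist u v * (exp (a * T) - 1)"
      using integral_unique[OF hi] by (simp add: algebra_simps diff_divide_distrib)
    also have "\<dots> \<le> 1/2 * dist u v * exp (a * T)"
      using La L a T by (intro mult_mono) auto
    finally have I: "norm (I u T - I v T) \<le> 1/2 * dist u v * exp (a * T)" .
    have "dist (\<Psi> u t) (\<Psi> v t) = exp (- a * T) * norm (I u T - I v T)"
      by (simp add: \<Psi> \<Phi>_def T_def dist_norm flip: scaleR_diff_right)
    also have "\<dots> \<le> exp (- a * T) * (1/2 * dist u v * exp (a * T))"
      by (intro mult_left_mono I) auto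
    also have "\<dots> = 1/2 * dist u v * (exp (- a * T) * exp (a * T))"
      by (simp only: ac_simps)
    also have "exp (- a * T) * exp (a * T) = 1"
      by (simp flip: exp_add)
    finally show "dist (\<Psi> u t) (\<Psi> v t) \<le> 1/2 * dist u v" by simp
  qed
  obtain u where u: "\<Psi> u = u"
    using banach_fix_type[of "1/2" \<Psi>] contr by auto
  define x where "x t = x0 + I u t" for t
  have xu: "x t = exp (a * t) *\<^sub>R u t" if "t \<ge> 0" for t
  proof -
    have "u t = exp (- a * t) *\<^sub>R x t"
      using that fun_cong[OF \<Psi>[of u], of t] by (simp add: u \<Phi>_def x_def)
    then show ?thesis by (simp flip: exp_add)
  qed
  show ?thesis
  proof (rule that[of x])
    show "x 0 = x0" by (simp add: x_def I_def)
    fix t :: real assume t: "t \<ge> 0"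
    have "(x has_vector_derivative g u t) (at t within {0..})"
      unfolding x_def using derI[OF t, of u] by (auto intro!: derivative_eq_intros)
    then show "(x has_vector_derivative f (x t)) (at t within {0..})"
      by (simp add: g_def xu[OF t])
  qed
qed

text \<open>Composing \<open>f\<close> with the nearest-point projection onto \<open>S\<close> gives
  a bounded field that is Lipschitz everywhere, so global existence applies. The curve obeys the
  original equation at every time when it lies in \<open>S\<close>; whether it stays there is left
  to the applications.\<close>

lemma lipschitz_on_compact_ode_solution:
  fixes f :: "'a::euclidean_space \<Rightarrow> 'a"
  assumes S: "compact S" "convex S" "x0 \<in> S" and lip: "L-lipschitz_on S f"
  obtains x where "x 0 = x0" "continuous_on {0..} x"
    "\<And>t. t \<ge> 0 \<Longrightarrow> x t \<in> S \<Longrightarrow> (x has_vector_derivative f (x t)) (at t within {0..})"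
proof -
  let ?p = "closest_point S"
  have cl: "closed S" "S \<noteq> {}" using S compact_imp_closed by auto
  have p: "?p y \<in> S" for y using cl by (rule closest_point_in_set)
  have "1-lipschitz_on UNIV ?p"
    using closest_point_lipschitz[OF S(2) cl] by (intro lipschitz_onI) auto
  then have "(L * 1)-lipschitz_on UNIV (\<lambda>y. f (?p y))"
    by (rule lipschitz_on_compose2) (rule lipschitz_on_subset[OF lip], use p in auto)
  moreover obtain B where "\<And>y. y \<in> S \<Longrightarrow> norm (f y) \<le> B"
    using compact_imp_bounded[OF compact_continuous_image[OF lipschitz_on_continuous_on[OF lip] S(1)]]
    by (auto simp: bounded_iff)
  then have "norm (f (?p y)) \<le> B" for y using p by auto
  ultimately obtain x where x: "x 0 = x0"
    "\<And>t. t \<ge> 0 \<Longrightarrow> (x has_vector_derivative f (?p (x t))) (at t within {0..})"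
    using lipschitz_ode_solution[of "L * 1" "\<lambda>y. f (?p y)" B x0] by blast
  show ?thesis
  proof (rule that[of x])
    show "x 0 = x0" by (rule x(1))
    show "continuous_on {0..} x"
      using x(2) by (intro continuous_on_vector_derivative) auto
    show "(x has_vector_derivative f (x t)) (at t within {0..})" if "t \<ge> 0" "x t \<in> S" for t
      using x(2)[OF that(1)] closest_point_self[OF that(2)] by simp
  qed
qed

section \<open>First exit times and monotonicity on an interval\<close>

lemma first_exit:
  fixes f :: "real \<Rightarrow> 'a::topological_space"
  assumes cont: "continuous_on {a..b} f" and "open U" "f a \<in> U" "f b \<notin> U" "a \<le> b"
  obtains t where "a < t" "t \<le> b" "f t \<notin> U" "\<And>s. s \<in> {a..<t} \<Longrightarrow> f s \<in> U"
proof -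
  let ?C = "{a..b} \<inter> f -` (- U)"
  have "closed ?C"
    using cont \<open>open U\<close> by (intro continuous_closed_preimage) auto
  then have "compact ?C"
    by (metis compact_Icc compact_Int_closed inf.left_idem)
  moreover have "?C \<noteq> {}" using assms by auto
  ultimately obtain t where t: "t \<in> ?C" "\<And>s. s \<in> ?C \<Longrightarrow> t \<le> s"
    using compact_attains_inf[of ?C] by blast
  show ?thesis
  proof (rule that[of t])
    show "a < t" using t(1) assms by (cases "t = a") auto
    show "f s \<in> U" if "s \<in> {a..<t}" for s
      using t(2)[of s] that t(1) by force
  qed (use t(1) in auto)
qed

lemma has_real_derivative_nonpos_imp_le:
  fixes f :: "real \<Rightarrow> real"
  assumes "a \<le> b" and der: "\<And>t. t \<in> {a..b} \<Longrightarrow> (f has_real_derivative f' t) (at t within {a..b})"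
    and "\<And>t. t \<in> {a..b} \<Longrightarrow> f' t \<le> 0"
  shows "f b \<le> f a"
proof (rule DERIV_nonpos_imp_decreasing_open[OF \<open>a \<le> b\<close>])
  show "continuous_on {a..b} f"
    using der by (rule DERIV_continuous_on)
  fix t assume "a < t" "t < b"
  then have "(f has_real_derivative f' t) (at t)"
    using der[of t] at_within_Icc_at[of a t b] by simp
  then show "\<exists>y. DERIV f t :> y \<and> y \<le> 0"
    using assms(3)[of t] \<open>a < t\<close> \<open>t < b\<close> by auto
qed

text \<open>The sign of \<open>f'\<close> is known only where \<open>f \<le> R\<close>. Up to the
  first time at which \<open>f\<close> reaches \<open>R\<close> it cannot increase, so there
  \<open>f t \<le> f a < R\<close>, a contradiction.\<close>

lemma stays_below:
  fixes f :: "real \<Rightarrow> real"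
  assumes "a \<le> b" and der: "\<And>t. t \<in> {a..b} \<Longrightarrow> (f has_real_derivative f' t) (at t within {a..b})"
    and nonpos: "\<And>t. t \<in> {a..b} \<Longrightarrow> f t \<le> R \<Longrightarrow> f' t \<le> 0" and "f a < R"
  shows "f b < R"
proof (rule ccontr)
  assume "\<not> f b < R"
  moreover have cont: "continuous_on {a..b} f"
    using der by (rule DERIV_continuous_on)
  ultimately obtain t where t: "a < t" "t \<le> b" "f t \<notin> {..<R}" "\<And>s. s \<in> {a..<t} \<Longrightarrow> f s \<in> {..<R}"
    using first_exit[of a b f "{..<R}"] assms by auto
  have "f t \<le> f a"
  proof (rule DERIV_nonpos_imp_decreasing_open[of a t f])
    show "continuous_on {a..t} f" using cont t by (auto intro: continuous_on_subset)
    fix s assume s: "a < s" "s < t"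
    then have "(f has_real_derivative f' s) (at s)"
      using der[of s] at_within_Icc_at[of a s b] t by simp
    moreover have "f' s \<le> 0"
      using t(4)[of s] s t(2) by (intro nonpos) auto
    ultimately show "\<exists>y. DERIV f s :> y \<and> y \<le> 0" by blast
  qed (use t in auto)
  with t assms show False by simp
qed

section \<open>Spectral theorem and characteristic polynomial\<close>

text \<open>A maximiser \<open>v\<close> of the quadratic form on the unit sphere of
  \<open>S\<close> works: with \<open>c\<close> the maximum, \<open>g = c - f\<close> is positive
  semidefinite on \<open>S\<close> and its form vanishes at \<open>v\<close>, which forces
  \<open>g v = 0\<close>.\<close>

lemma selfadjoint_eigenvector_exists:
  fixes f :: "'a::euclidean_space \<Rightarrow> 'a"
  assumes lin: "linear f" and sa: "\<And>x y. f x \<bullet> y = x \<bullet> f y"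
    and S: "subspace S" and inv: "\<And>x. x \<in> S \<Longrightarrow> f x \<in> S" and "S \<noteq> {0}"
  obtains v c where "v \<in> S" "norm v = 1" "f v = c *\<^sub>R v"
proof -
  interpret linear f by (rule lin)
  have "compact (S \<inter> sphere 0 1)"
    using closed_subspace[OF S] by (intro closed_Int_compact) auto
  moreover obtain y where y: "y \<in> S" "y \<noteq> 0"
    using \<open>S \<noteq> {0}\<close> subspace_0[OF S] by auto
  then have "y /\<^sub>R norm y \<in> S \<inter> sphere 0 1"
    using S by (auto simp: subspace_scale)
  then have "S \<inter> sphere 0 1 \<noteq> {}" by blast
  moreover have "continuous_on (S \<inter> sphere 0 1) (\<lambda>x. x \<bullet> f x)"
    by (intro continuous_intros linear_continuous_on linear_conv_bounded_linear[THEN iffD1] lin)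
  ultimately obtain v where v: "v \<in> S" "norm v = 1"
    and max: "\<And>x. x \<in> S \<Longrightarrow> norm x = 1 \<Longrightarrow> x \<bullet> f x \<le> v \<bullet> f v"
    using continuous_attains_sup[of "S \<inter> sphere 0 1" "\<lambda>x. x \<bullet> f x"]
    by (metis Int_iff mem_sphere_0)
  define c where "c = v \<bullet> f v"
  define g where "g x = c *\<^sub>R x - f x" for x
  have psd: "x \<bullet> g x \<ge> 0" if "x \<in> S" for x
  proof (cases "x = 0")
    case False
    define y where "y = x /\<^sub>R norm x"
    have "y \<in> S" "norm y = 1" and x: "x = norm x *\<^sub>R y"
      using False that S by (auto simp: y_def subspace_scale)
    then have "y \<bullet> f y \<le> c" using max by (simp add: c_def)
    then have "0 \<le> y \<bullet> g y"
      using \<open>norm y = 1\<close> by (simp add: g_def inner_diff_right norm_eq_1)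
    moreover have "x \<bullet> g x = (norm x)\<^sup>2 * (y \<bullet> g y)"
      by (subst (1 2) x) (simp add: g_def scaleR inner_diff_right power2_eq_square algebra_simps)
    ultimately show ?thesis by simp
  qed (simp add: g_def)
  define w where "w = g v"
  have w: "w \<in> S"
    using v inv S by (simp add: w_def g_def subspace_diff subspace_scale)
  have vw: "v \<bullet> w = 0"
    using v by (simp add: w_def g_def c_def inner_diff_right norm_eq_1)
  have gsa: "v \<bullet> g x = w \<bullet> x" for x
    by (simp add: w_def g_def inner_diff_right inner_diff_left sa)
  \<comment> \<open>Expand the nonnegative form of \<open>g\<close> at
    \<open>v - s *\<^sub>R w\<close>; its constant term is \<open>v \<bullet> w = 0\<close>. For
    small positive \<open>s\<close> the linear term would win unless \<open>w = 0\<close>.\<close>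
  have quad: "2 * s * (w \<bullet> w) \<le> s\<^sup>2 * (w \<bullet> g w)" for s
  proof -
    have gw: "v \<bullet> g w = w \<bullet> w"
      using gsa .
    have "0 \<le> (v - s *\<^sub>R w) \<bullet> g (v - s *\<^sub>R w)"
      using psd v w S by (simp add: subspace_diff subspace_scale)
    also have "g (v - s *\<^sub>R w) = w - s *\<^sub>R g w"
      unfolding w_def[symmetric] by (simp add: g_def diff scale) (simp add: w_def g_def algebra_simps)
    also have "(v - s *\<^sub>R w) \<bullet> (w - s *\<^sub>R g w) = s\<^sup>2 * (w \<bullet> g w) - 2 * s * (w \<bullet> w)"
      using vw gw by (simp add: inner_diff_left inner_diff_right power2_eq_square algebra_simps)
    finally show ?thesis by simp
  qed
  have "w = 0"
  proof (rule ccontr)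
    assume "w \<noteq> 0"
    then have d: "w \<bullet> w > 0" by simp
    define q where "q = w \<bullet> g w"
    have q: "q \<ge> 0" using psd[OF w] by (simp add: q_def)
    define s where "s = (w \<bullet> w) / (q + 1)"
    have s: "s > 0" using d q by (simp add: s_def)
    have "s * (2 * (w \<bullet> w)) \<le> s * (s * q)"
      using quad[of s] by (simp add: q_def power2_eq_square algebra_simps)
    then have "2 * (w \<bullet> w) \<le> s * q" using s by simp
    also have "\<dots> \<le> w \<bullet> w" using d q by (simp add: s_def field_simps)
    finally show False using d by simp
  qed
  then have "f v = c *\<^sub>R v" by (simp add: w_def g_def)
  with v show ?thesis using that by blast
qed

text \<open>Induction on the dimension: split off a unit eigenvector; by self-adjointness its
  orthogonal complement within \<open>S\<close> is again invariant.\<close>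

lemma selfadjoint_orthonormal_eigenbasis:
  fixes f :: "'a::euclidean_space \<Rightarrow> 'a"
  assumes lin: "linear f" and sa: "\<And>x y. f x \<bullet> y = x \<bullet> f y"
    and "subspace S" and "\<And>x. x \<in> S \<Longrightarrow> f x \<in> S"
  shows "\<exists>B\<subseteq>S. pairwise orthogonal B \<and> (\<forall>b\<in>B. norm b = 1 \<and> (\<exists>c. f b = c *\<^sub>R b)) \<and> span B = S"
  using assms(3,4)
proof (induction "dim S" arbitrary: S rule: less_induct)
  case less
  show ?case
  proof (cases "S = {0}")
    case True
    then show ?thesis by (intro exI[of _ "{}"]) auto
  next
    case False
    with lin sa less.prems obtain v c where v: "v \<in> S" "norm v = 1" "f v = c *\<^sub>R v"
      using selfadjoint_eigenvector_exists[of f S] by metis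
    define S' where "S' = {x \<in> S. x \<bullet> v = 0}"
    have sub: "subspace S'"
      using less.prems(1) by (auto simp: S'_def subspace_def inner_add_left)
    have "v \<notin> S'" using v by (auto simp: S'_def)
    moreover have "S' \<subseteq> S" by (auto simp: S'_def)
    ultimately have "S' \<subset> S" using v(1) by blast
    then have "span S' \<subset> span S"
      using less.prems(1) sub by (simp add: span_eq_iff[THEN iffD2])
    then have "dim S' < dim S" by (rule dim_psubset)
    moreover have "f x \<in> S'" if "x \<in> S'" for x
      using that less.prems(2) v(3) by (auto simp: S'_def sa)
    ultimately obtain B where B: "B \<subseteq> S'" "pairwise orthogonal B"
      "\<forall>b\<in>B. norm b = 1 \<and> (\<exists>c. f b = c *\<^sub>R b)" "span B = S'"
      using less.hyps[OF _ sub] by blast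
    have "span (insert v B) = S"
    proof
      show "span (insert v B) \<subseteq> S"
        using B(1) v(1) less.prems(1) by (intro span_minimal) (auto simp: S'_def)
      show "S \<subseteq> span (insert v B)"
      proof
        fix x assume "x \<in> S"
        then have "x - (x \<bullet> v) *\<^sub>R v \<in> S'"
          using v less.prems(1)
          by (auto simp: S'_def subspace_diff subspace_scale inner_diff_left norm_eq_1)
        with B(4) show "x \<in> span (insert v B)"
          by (auto simp: span_insert)
      qed
    qed
    moreover have "pairwise orthogonal (insert v B)"
      using B by (auto simp: pairwise_insert S'_def orthogonal_def inner_commute)
    ultimately show ?thesis
      using B v by (intro exI[of _ "insert v B"]) (auto simp: S'_def)
  qed
qed

text \<open>In the coordinates of the orthonormal family, \<open>T\<close> multiplies the
  coefficient at \<open>b\<close> by \<open>\<tau> b\<close>, and Pythagoras compares the two norms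
  term by term.\<close>

lemma diagonalizable_norm_lower_bound:
  fixes T :: "'a::euclidean_space \<Rightarrow> 'a"
  assumes lin: "linear T" and B: "pairwise orthogonal B" "\<And>b. b \<in> B \<Longrightarrow> norm b = 1" "finite B"
    and T: "\<And>b. b \<in> B \<Longrightarrow> T b = \<tau> b *\<^sub>R b" and \<kappa>: "0 \<le> \<kappa>" "\<And>b. b \<in> B \<Longrightarrow> \<kappa> \<le> \<bar>\<tau> b\<bar>"
    and x: "x \<in> span B"
  shows "\<kappa> * norm x \<le> norm (T x)"
proof -
  interpret linear T by (rule lin)
  have orth: "pairwise (\<lambda>b d. orthogonal (f b *\<^sub>R b) (f d *\<^sub>R d)) B" for f
    using B(1) by (auto simp: pairwise_def orthogonal_def)
  have xe: "x = (\<Sum>b\<in>B. (x \<bullet> b) *\<^sub>R b)"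
    using orthonormal_basis_expand[OF B(1,2) x B(3)] by simp
  have "T x = (\<Sum>b\<in>B. (x \<bullet> b * \<tau> b) *\<^sub>R b)"
    by (subst xe) (simp add: sum scale T)
  then have "(norm (T x))\<^sup>2 = (\<Sum>b\<in>B. (x \<bullet> b)\<^sup>2 * \<bar>\<tau> b\<bar>\<^sup>2)"
    using norm_sum_Pythagorean[OF B(3) orth, of "\<lambda>b. x \<bullet> b * \<tau> b"]
    by (simp add: B power_mult_distrib)
  moreover have "(norm x)\<^sup>2 = (\<Sum>b\<in>B. (x \<bullet> b)\<^sup>2)"
    by (subst xe, subst norm_sum_Pythagorean[OF B(3) orth]) (simp add: B)
  moreover have "\<kappa>\<^sup>2 * (\<Sum>b\<in>B. (x \<bullet> b)\<^sup>2) \<le> (\<Sum>b\<in>B. (x \<bullet> b)\<^sup>2 * \<bar>\<tau> b\<bar>\<^sup>2)"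
    unfolding sum_distrib_left
    by (rule sum_mono, subst mult.commute) (intro mult_left_mono power_mono \<kappa>, auto)
  ultimately have "(\<kappa> * norm x)\<^sup>2 \<le> (norm (T x))\<^sup>2"
    by (simp add: power_mult_distrib)
  then show ?thesis by (rule power2_le_imp_le) simp
qed

section \<open>Characteristic polynomial and spectral gap from an eigenbasis\<close>

lemma poly_charpoly: "poly (charpoly A) x = det (mat x - A)"
proof -
  have "poly (charpoly A) x
      = (\<Sum>p | p permutes UNIV. of_int (sign p) *
          (\<Prod>i\<in>UNIV. poly ((mat [:0, 1:] - (\<chi> i j. [:A $ i $ j:])) $ i $ p i) x))"
    by (simp add: charpoly_def det_def poly_sum poly_prod)
  also have "\<dots> = det (mat x - A)"
    unfolding det_def
    by (intro sum.cong prod.cong arg_cong2[of _ _ _ _ "(*)"] refl) (simp add: mat_def)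
  finally show ?thesis .
qed

text \<open>With the eigenvectors as columns of \<open>Q\<close>, \<open>(x - A) Q = Q D\<close> for
  the diagonal matrix \<open>D\<close> of the \<open>x - c i\<close>. Cancelling
  \<open>det Q\<close> gives equality at every real \<open>x\<close>, hence of polynomials.\<close>

lemma charpoly_orthonormal_eigenbasis:
  fixes A :: "real^'n^'n" and e :: "'n \<Rightarrow> real^'n"
  assumes norm: "\<And>i. norm (e i) = 1" and orth: "\<And>i j. i \<noteq> j \<Longrightarrow> orthogonal (e i) (e j)"
    and eig: "\<And>i. A *v e i = c i *\<^sub>R e i"
  shows "charpoly A = (\<Prod>i\<in>UNIV. [:- c i, 1:])"
proof (rule poly_eq_poly_eq_iff[THEN iffD1], rule ext)
  fix x
  define Q :: "real^'n^'n" where "Q = (\<chi> i j. e j $ i)"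
  define D :: "real^'n^'n" where "D = (\<chi> i j. if i = j then x - c i else 0)"
  have col: "column j Q = e j" for j by (simp add: Q_def column_def vec_eq_iff)
  have "orthogonal_matrix Q"
    unfolding orthogonal_matrix_orthonormal_columns col using norm orth by blast
  then have "det Q \<noteq> 0" using det_orthogonal_matrix by fastforce
  have "((mat x - A) ** Q) $ i $ j = (Q ** D) $ i $ j" for i j
  proof -
    have "((mat x - A) ** Q) $ i $ j = ((mat x - A) *v e j) $ i"
      by (simp add: matrix_matrix_mult_def matrix_vector_mult_def Q_def)
    also have "\<dots> = (x - c j) * e j $ i"
    proof -
      have "(mat x *v e j) $ i = x * e j $ i"
        by (simp add: matrix_vector_mult_def mat_def if_distrib[of "\<lambda>y. y * _"] cong: if_cong)
      then show ?thesis
        by (simp add: matrix_vector_mult_diff_rdistrib eig algebra_simps)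
    qed
    also have "\<dots> = (Q ** D) $ i $ j"
      by (simp add: matrix_matrix_mult_def Q_def D_def if_distrib cong: if_cong)
    finally show ?thesis .
  qed
  then have "(mat x - A) ** Q = Q ** D" by (simp add: vec_eq_iff)
  then have "det (mat x - A) * det Q = det Q * det D"
    by (metis det_mul)
  then have "det (mat x - A) = det D" using \<open>det Q \<noteq> 0\<close> by simp
  also have "\<dots> = (\<Prod>i\<in>UNIV. x - c i)"
    by (subst det_diagonal) (auto simp: D_def)
  finally show "poly (charpoly A) x = poly (\<Prod>i\<in>UNIV. [:- c i, 1:]) x"
    by (simp add: poly_charpoly poly_prod)
qed

text \<open>This trades positions in the sorted eigenvalue list for indices of eigenvectors. The
  list ends in \<open>c m\<close>, so dropping its last position means dropping the index
  \<open>m\<close>; a repeated top eigenvalue stays in the range and gives gap 0.\<close>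

lemma spectral_gap_orthonormal_eigenbasis:
  fixes A :: "real^'n^'n" and e :: "'n \<Rightarrow> real^'n"
  assumes norm: "\<And>i. norm (e i) = 1" and orth: "\<And>i j. i \<noteq> j \<Longrightarrow> orthogonal (e i) (e j)"
    and eig: "\<And>i. A *v e i = c i *\<^sub>R e i" and max: "\<And>i. c i \<le> c m"
  shows "spectral_gap A = Min ((\<lambda>i. c m - c i) ` (- {m}))"
proof -
  define l where "l = sorted_list_of_multiset (image_mset c (mset_set (- {m})))"
  have "proots (charpoly A) = image_mset c (mset_set UNIV)"
    using charpoly_orthonormal_eigenbasis[OF norm orth eig]
    by (simp add: proots_prod sum_unfold_sum_mset image_mset.compositionality o_def)
  also have "mset_set UNIV = add_mset m (mset_set (- {m}))"
    by (metis Compl_eq_Diff_UNIV UNIV_I finite_code mset_set.remove)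
  finally have pr: "proots (charpoly A) = mset (l @ [c m])"
    by (simp add: l_def)
  have "sorted (l @ [c m])"
    using max by (auto simp: sorted_append l_def)
  then have ev: "eigvals A = l @ [c m]"
    unfolding eigvals_def pr by (simp only: sorted_list_of_multiset_mset) (rule sorted_sort_id)
  have "length l = CARD('n) - 1"
    by (simp add: l_def flip: size_mset) (simp add: Compl_eq_Diff_UNIV card_Diff_singleton)
  then have "(\<lambda>i. eigvals A ! (CARD('n) - 1) - eigvals A ! i) ` {..<CARD('n) - 1}
      = (\<lambda>y. c m - y) ` ((!) l ` {..<length l})"
    by (auto simp: ev nth_append image_image intro!: image_cong)
  also have "(!) l ` {..<length l} = set l"
    by (auto simp: set_conv_nth)
  also have "set l = c ` (- {m})" by (simp add: l_def)
  finally show ?thesis by (simp add: spectral_gap_def image_image)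
qed

section \<open>Lipschitz functions\<close>

text \<open>Compactness bounds both factors. Constants are kept existential here and below so that
  these facts chain up to \<open>field_lipschitz\<close> without bookkeeping.\<close>

lemma ex_lipschitz_on_mult:
  fixes f g :: "'a::metric_space \<Rightarrow> real"
  assumes S: "compact S" and "\<exists>C. C-lipschitz_on S f" "\<exists>D. D-lipschitz_on S g"
  shows "\<exists>L. L-lipschitz_on S (\<lambda>x. f x * g x)"
proof -
  obtain C D where C: "C-lipschitz_on S f" and D: "D-lipschitz_on S g" using assms by blast
  have "bounded (f ` S)" "bounded (g ` S)"
    using C D S by (auto intro!: compact_imp_bounded compact_continuous_image dest: lipschitz_on_continuous_on)
  then obtain A B where A: "\<And>x. x \<in> S \<Longrightarrow> \<bar>f x\<bar> \<le> A" and B: "\<And>x. x \<in> S \<Longrightarrow> \<bar>g x\<bar> \<le> B"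
    by (auto simp: bounded_iff)
  have "(\<bar>A\<bar> * D + \<bar>B\<bar> * C)-lipschitz_on S (\<lambda>x. f x * g x)"
  proof (rule lipschitz_onI)
    fix x y assume xy: "x \<in> S" "y \<in> S"
    have "f x * g x - f y * g y = f x * (g x - g y) + g y * (f x - f y)"
      by (simp add: algebra_simps)
    then have "dist (f x * g x) (f y * g y) \<le> \<bar>f x\<bar> * \<bar>g x - g y\<bar> + \<bar>g y\<bar> * \<bar>f x - f y\<bar>"
      unfolding dist_real_def by (metis abs_mult abs_triangle_ineq)
    also have "\<dots> \<le> \<bar>A\<bar> * (D * dist x y) + \<bar>B\<bar> * (C * dist x y)"
      using A[OF xy(1)] B[OF xy(2)] lipschitz_onD[OF C xy] lipschitz_onD[OF D xy]
      by (intro add_mono mult_mono) (auto simp: dist_real_def)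
    finally show "dist (f x * g x) (f y * g y) \<le> (\<bar>A\<bar> * D + \<bar>B\<bar> * C) * dist x y"
      by (simp add: algebra_simps)
  qed (use lipschitz_on_nonneg[OF C] lipschitz_on_nonneg[OF D] in simp)
  then show ?thesis by blast
qed

lemma ex_lipschitz_on_inverse:
  fixes f :: "'a::metric_space \<Rightarrow> real"
  assumes S: "compact S" and "\<exists>C. C-lipschitz_on S f" and pos: "\<And>x. x \<in> S \<Longrightarrow> f x > 0"
  shows "\<exists>L. L-lipschitz_on S (\<lambda>x. inverse (f x))"
proof (cases "S = {}")
  case False
  obtain C where C: "C-lipschitz_on S f" using assms by blast
  obtain m where m: "m \<in> S" "\<And>x. x \<in> S \<Longrightarrow> f m \<le> f x"
    using continuous_attains_inf[OF S False lipschitz_on_continuous_on[OF C]] by blast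
  have "(C / (f m * f m))-lipschitz_on S (\<lambda>x. inverse (f x))"
  proof (rule lipschitz_onI)
    fix x y assume xy: "x \<in> S" "y \<in> S"
    have "dist (inverse (f x)) (inverse (f y)) = dist (f x) (f y) / (f x * f y)"
      using pos[OF xy(1)] pos[OF xy(2)]
      by (simp add: dist_real_def inverse_diff_inverse abs_mult abs_minus_commute field_simps)
    also have "\<dots> \<le> C * dist x y / (f m * f m)"
      using lipschitz_onD[OF C xy] m(2)[OF xy(1)] m(2)[OF xy(2)] pos[OF m(1)]
        lipschitz_on_nonneg[OF C]
      by (intro frac_le mult_mono) auto
    finally show "dist (inverse (f x)) (inverse (f y)) \<le> C / (f m * f m) * dist x y" by simp
  qed (use lipschitz_on_nonneg[OF C] in simp)
  then show ?thesis by blast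
qed (auto intro!: exI[of _ 0])

lemma ex_lipschitz_on_exp:
  fixes f :: "'a::metric_space \<Rightarrow> real"
  assumes "\<exists>C. C-lipschitz_on S f" and neg: "\<And>x. x \<in> S \<Longrightarrow> f x \<le> 0"
  shows "\<exists>L. L-lipschitz_on S (\<lambda>x. exp (f x))"
proof -
  obtain C where C: "C-lipschitz_on S f" using assms by blast
  have "1-lipschitz_on {..0::real} exp"
  proof (rule lipschitz_on_leI)
    fix x y :: real assume xy: "x \<in> {..0}" "y \<in> {..0}" "x \<le> y"
    have "exp y - exp x = exp y * (1 - exp (x - y))"
      by (simp add: right_diff_distrib flip: exp_add)
    also have "\<dots> \<le> 1 * (1 - exp (x - y))"
      using xy by (intro mult_right_mono) auto
    also have "1 - exp (x - y) \<le> y - x"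
      using exp_ge_add_one_self[of "x - y"] by linarith
    finally have "exp y - exp x \<le> y - x" by simp
    then show "dist (exp x) (exp y) \<le> 1 * dist x y"
      using xy by (simp add: dist_real_def)
  qed simp
  then have "1-lipschitz_on (f ` S) exp"
    by (rule lipschitz_on_subset) (use neg in auto)
  from lipschitz_on_compose2[OF C this] show ?thesis by blast
qed

lemma ex_lipschitz_on_vec:
  fixes f :: "'a::metric_space \<Rightarrow> real^'n"
  assumes "\<And>i. \<exists>L. L-lipschitz_on S (\<lambda>x. f x $ i)"
  shows "\<exists>L. L-lipschitz_on S f"
proof -
  obtain L where L: "\<And>i. (L i)-lipschitz_on S (\<lambda>x. f x $ i)" using assms by metis
  have "(\<Sum>i\<in>UNIV. L i)-lipschitz_on S f"
  proof (rule lipschitz_onI)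
    fix x y assume xy: "x \<in> S" "y \<in> S"
    have "dist (f x) (f y) \<le> (\<Sum>i\<in>UNIV. \<bar>(f x - f y) $ i\<bar>)"
      unfolding dist_norm by (rule norm_le_l1_cart)
    also have "\<dots> \<le> (\<Sum>i\<in>UNIV. L i * dist x y)"
      using lipschitz_onD[OF L xy] by (intro sum_mono) (auto simp: dist_real_def)
    finally show "dist (f x) (f y) \<le> (\<Sum>i\<in>UNIV. L i) * dist x y"
      by (simp add: sum_distrib_right)
  qed (use lipschitz_on_nonneg[OF L] in \<open>auto intro: sum_nonneg\<close>)
  then show ?thesis by blast
qed

section \<open>Mean and relative deviation of a positive vector\<close>

definition mean :: "real^'n \<Rightarrow> real" where
  "mean x = (\<Sum>i\<in>UNIV. x $ i) / real CARD('n)"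

lemma inner_one: "x \<bullet> (1 :: real^'n) = real CARD('n) * mean x"
  by (simp add: mean_def inner_vec_def)

lemma bounded_linear_mean: "bounded_linear (mean :: real^'n \<Rightarrow> real)"
proof -
  have eq: "(mean :: real^'n \<Rightarrow> real) = (\<lambda>x. (x \<bullet> 1) / real CARD('n))"
    by (simp add: inner_one fun_eq_iff)
  show ?thesis
    unfolding eq by (rule bounded_linear_compose[OF bounded_linear_divide bounded_linear_inner_left])
qed

lemmas mean_linear_simps = bounded_linear.axioms(1)[OF bounded_linear_mean, THEN linear_add]
  bounded_linear.axioms(1)[OF bounded_linear_mean, THEN linear_diff]
  bounded_linear.axioms(1)[OF bounded_linear_mean, THEN linear_cmul]

lemma mean_one [simp]: "mean 1 = 1"
  by (simp add: mean_def)

text \<open>The \<epsilon> of the outline; \<open>1\<close> is the all-ones vector. Positive scaling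
  of \<open>x\<close> does not change it, so it records the direction alone.\<close>

definition dev :: "real^'n \<Rightarrow> real^'n" where
  "dev x = x /\<^sub>R mean x - 1"

lemma open_H: "open (H :: (real^'n) set)"
proof -
  have H: "H = (\<Inter>i. {x::real^'n. 0 < x $ i})" by (auto simp: H_def)
  show ?thesis unfolding H by (intro open_INT ballI open_Collect_less continuous_intros) auto
qed

lemma mean_pos: "x \<in> H \<Longrightarrow> mean x > 0"
  by (auto simp: mean_def H_def intro!: divide_pos_pos sum_pos)

lemma mean_dev: "x \<in> H \<Longrightarrow> mean (dev x) = 0"
  using mean_pos[of x] by (simp add: dev_def mean_linear_simps)

lemma mean_scaleR_one_plus_dev: "x \<in> H \<Longrightarrow> mean x *\<^sub>R (1 + dev x) = x"
  using mean_pos[of x] by (simp add: dev_def)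

lemma norm_le_l1norm: "norm x \<le> l1norm x"
  by (simp add: l1norm_def norm_le_l1_cart)

lemma l1norm_scaleR: "l1norm (a *\<^sub>R x) = \<bar>a\<bar> * l1norm x"
  by (simp add: l1norm_def abs_mult sum_distrib_left)

text \<open>For positive \<open>x\<close> the \<open>l1norm\<close> is
  \<open>CARD('n) * mean x\<close>, so the vector measured in \<open>diag_cone\<close> is
  \<open>dev x\<close> divided by the number of vertices.\<close>

lemma diag_cone_iff:
  fixes x :: "real^'n"
  shows "x \<in> diag_cone u \<longleftrightarrow> x \<in> H \<and> l1norm (dev x) \<le> real CARD('n) * u"
proof (cases "x \<in> H")
  case True
  have "l1norm x = real CARD('n) * mean x"
    using True by (auto simp: l1norm_def mean_def H_def intro!: sum.cong) (metis abs_of_pos)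
  then have "x /\<^sub>R l1norm x - (\<chi> i. 1 / real CARD('n)) = (1 / real CARD('n)) *\<^sub>R dev x"
    by (simp add: dev_def vec_eq_iff field_simps)
  then show ?thesis
    using True by (simp add: diag_cone_def l1norm_scaleR field_simps)
qed (simp add: diag_cone_def)

lemma has_derivative_vecI:
  fixes f :: "'a::euclidean_space \<Rightarrow> real^'n"
  assumes "\<And>i. ((\<lambda>x. f x $ i) has_derivative (\<lambda>h. f' h $ i)) (at a within S)"
  shows "(f has_derivative f') (at a within S)"
  unfolding has_derivative_componentwise_within[of f]
  using assms by (auto simp: Basis_vec_def inner_axis)

lemma nth_lower_bound:
  assumes "x \<in> H" "norm (dev x) \<le> 1/2"
  shows "mean x / 2 \<le> x $ i" "x $ i \<le> 3/2 * mean x"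
proof -
  have "\<bar>dev x $ i\<bar> \<le> 1/2"
    using component_le_norm_cart[of "dev x" i] assms(2) by linarith
  then have "1/2 \<le> 1 + dev x $ i" "1 + dev x $ i \<le> 3/2" by (auto simp: abs_le_iff)
  moreover have "x $ i = mean x * (1 + dev x $ i)"
    using arg_cong[OF mean_scaleR_one_plus_dev[OF assms(1)], of "\<lambda>y. y $ i"] by simp
  ultimately show "mean x / 2 \<le> x $ i" "x $ i \<le> 3/2 * mean x"
    using mean_pos[OF assms(1)] mult_left_mono[of "1/2" "1 + dev x $ i" "mean x"]
      mult_left_mono[of "1 + dev x $ i" "3/2" "mean x"] by auto
qed

lemma tendsto_0_norm_square_bound:
  assumes "\<forall>\<^sub>F t in Fl. (norm (f t))\<^sup>2 \<le> g t" "(g \<longlongrightarrow> 0) Fl"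
  shows "(f \<longlongrightarrow> 0) Fl"
proof -
  have "((\<lambda>t. (norm (f t))\<^sup>2) \<longlongrightarrow> 0) Fl"
    by (rule real_tendsto_sandwich[OF _ assms(1) tendsto_const assms(2)]) simp
  then have "((\<lambda>t. sqrt ((norm (f t))\<^sup>2)) \<longlongrightarrow> sqrt 0) Fl"
    by (rule tendsto_real_sqrt)
  then show ?thesis by (simp add: tendsto_norm_zero_iff)
qed

section \<open>The vector field near the diagonal\<close>

locale regular_graph =
  fixes E :: "'n::finite \<Rightarrow> 'n \<Rightarrow> bool" and V :: nat and lam :: real
  assumes lam_pos: "lam > 0" and two_vertices: "CARD('n) \<ge> 2"
    and undirected: "symp E" and regular: "\<And>i. card (nbhd E i) = V"
begin

definition nsum :: "real^'n \<Rightarrow> 'n \<Rightarrow> real" where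
  "nsum x i = (\<Sum>j\<in>nbhd E i. x $ j)"

text \<open>The L of the outline. For regular neighbourhoods it is the sum of
  \<open>x $ i - x $ j\<close> over \<open>j \<in> nbhd E i\<close>, where \<open>j = i\<close>
  contributes 0: the usual graph Laplacian.\<close>

definition lap :: "real^'n \<Rightarrow> real^'n" where
  "lap x = (\<chi> i. real V * x $ i - nsum x i)"

text \<open>\<open>field\<close>, \<open>drift\<close>, \<open>growth\<close> and
  \<open>coupling\<close> are G, P, c and k of the outline; \<open>gap\<close> is \<gamma>.\<close>

definition field :: "real^'n \<Rightarrow> real^'n" where
  "field x = F lam E (phi E x)"

definition drift :: "real^'n \<Rightarrow> real^'n" where
  "drift x = field (1 + x) - mean (field (1 + x)) *\<^sub>R (1 + x)"

abbreviation gap :: real where "gap \<equiv> spectral_gap (nbhd_matrix E)"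

definition growth :: real where "growth = lam - exp (-1) / real V"

definition coupling :: real where "coupling = exp (-1) / real V ^ 3"

section \<open>The graph Laplacian and its spectrum\<close>

lemma nbhd_sym: "j \<in> nbhd E i \<longleftrightarrow> i \<in> nbhd E j"
  using undirected by (auto simp: nbhd_def symp_def)

lemma V_pos: "V > 0"
  using regular[of undefined] by (metis card_gt_0_iff finite insert_not_empty nbhd_def)

lemma coupling_pos: "coupling > 0"
  using V_pos by (simp add: coupling_def)

lemma nsum_matrix: "nsum x i = (nbhd_matrix E *v x) $ i"
  by (simp add: nsum_def nbhd_matrix_def matrix_vector_mult_def if_distrib[of "\<lambda>y. y * _"]
      flip: sum.inter_filter cong: if_cong)

lemma lap_matrix: "lap x = real V *\<^sub>R x - nbhd_matrix E *v x"
  by (simp add: vec_eq_iff lap_def nsum_matrix)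

lemma linear_lap: "linear lap"
  unfolding lap_matrix[abs_def]
  by (intro linear_compose_sub matrix_vector_mul_linear linear_scale_self)

lemma lap_selfadjoint: "lap x \<bullet> y = x \<bullet> lap y"
proof -
  have "transpose (nbhd_matrix E) = nbhd_matrix E"
    by (simp add: transpose_def nbhd_matrix_def vec_eq_iff nbhd_sym)
  then have "(nbhd_matrix E *v x) \<bullet> y = x \<bullet> (nbhd_matrix E *v y)"
    by (metis dot_lmul_matrix transpose_matrix_vector)
  then show ?thesis by (simp add: lap_matrix inner_diff_left inner_diff_right)
qed

lemma lap_one: "lap 1 = 0"
  by (simp add: lap_def nsum_def regular vec_eq_iff)

lemma mean_lap: "mean (lap x) = 0"
  using lap_selfadjoint[of x 1] inner_one[of "lap x"] by (simp add: lap_one)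

text \<open>Dirichlet form: \<open>2 * (x \<bullet> lap x)\<close> is the sum of
  \<open>(x $ i - x $ j)\<^sup>2\<close> over ordered pairs of neighbours. Together with
  \<open>lap_one\<close>, this makes \<open>V\<close> the largest eigenvalue of the neighbourhood
  matrix.\<close>

lemma lap_psd: "x \<bullet> lap x \<ge> 0"
proof -
  define a where "a i j = (if j \<in> nbhd E i then 1 else 0::real)" for i j
  have row: "(\<Sum>j\<in>UNIV. a i j) = real V" for i
    by (simp add: a_def regular flip: sum.inter_filter)
  have ns: "nsum x i = (\<Sum>j\<in>UNIV. a i j * x $ j)" for i
    by (simp add: nsum_def a_def if_distrib[of "\<lambda>y. y * _"] flip: sum.inter_filter cong: if_cong)
  have sym: "a i j = a j i" for i j by (simp add: a_def nbhd_sym)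
  have 1: "(\<Sum>i\<in>UNIV. \<Sum>j\<in>UNIV. a i j * (x $ i)\<^sup>2) = real V * (\<Sum>i\<in>UNIV. (x $ i)\<^sup>2)"
    by (simp add: row sum_distrib_left flip: sum_distrib_right)
  then have 2: "(\<Sum>i\<in>UNIV. \<Sum>j\<in>UNIV. a i j * (x $ j)\<^sup>2) = real V * (\<Sum>i\<in>UNIV. (x $ i)\<^sup>2)"
    by (subst sum.swap) (simp add: sym)
  have 3: "(\<Sum>i\<in>UNIV. \<Sum>j\<in>UNIV. a i j * (x $ i * x $ j)) = (\<Sum>i\<in>UNIV. x $ i * nsum x i)"
    by (simp add: ns sum_distrib_left ac_simps)
  have "0 \<le> (\<Sum>i\<in>UNIV. \<Sum>j\<in>UNIV. a i j * (x $ i - x $ j)\<^sup>2)"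
    by (intro sum_nonneg) (simp add: a_def)
  also have "\<dots> = (\<Sum>i\<in>UNIV. \<Sum>j\<in>UNIV. a i j * (x $ i)\<^sup>2) + (\<Sum>i\<in>UNIV. \<Sum>j\<in>UNIV. a i j * (x $ j)\<^sup>2)
      - 2 * (\<Sum>i\<in>UNIV. \<Sum>j\<in>UNIV. a i j * (x $ i * x $ j))"
    by (simp add: power2_eq_square algebra_simps sum.distrib sum_subtractf sum_distrib_left)
  also have "\<dots> = 2 * (x \<bullet> lap x)"
    unfolding 1 2 3
    by (simp add: inner_vec_def lap_def power2_eq_square algebra_simps sum_subtractf sum_distrib_left)
  finally show ?thesis by simp
qed

text \<open>Identifies \<open>gap\<close>, defined through the characteristic polynomial of the
  neighbourhood matrix, with the least eigenvalue of \<open>lap\<close> on vectors of mean zero.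
  Adjoining the normalised all-ones vector to an eigenbasis of that space gives a full eigenbasis,
  in which this vector carries the top eigenvalue \<open>V\<close>.\<close>

lemma laplacian_eigenbasis:
  obtains B g where "pairwise orthogonal B" "\<And>b. b \<in> B \<Longrightarrow> norm b = 1" "finite B"
    "span B = {x. mean x = 0}" "\<And>b. b \<in> B \<Longrightarrow> lap b = g b *\<^sub>R b"
    "\<And>b. b \<in> B \<Longrightarrow> gap \<le> g b" "\<exists>b\<in>B. g b = gap" "gap \<ge> 0"
proof -
  define S where "S = {x::real^'n. mean x = 0}"
  interpret L: linear lap by (rule linear_lap)
  have "subspace S" by (auto simp: S_def subspace_def mean_linear_simps) (simp add: mean_def)
  then obtain B where B: "B \<subseteq> S" "pairwise orthogonal B" "span B = S"
      "\<And>b. b \<in> B \<Longrightarrow> norm b = 1" "\<And>b. b \<in> B \<Longrightarrow> \<exists>c. lap b = c *\<^sub>R b"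
    using selfadjoint_orthonormal_eigenbasis[OF linear_lap lap_selfadjoint, of S]
    by (auto simp: S_def mean_lap)
  define e0 :: "real^'n" where "e0 = 1 /\<^sub>R norm (1::real^'n)"
  have n1: "norm (1::real^'n) \<noteq> 0" by (simp add: vec_eq_iff)
  have e0: "norm e0 = 1" "lap e0 = 0 *\<^sub>R e0"
    using n1 by (simp_all add: e0_def L.scale lap_one)
  have orth0: "orthogonal b e0" if "b \<in> B" for b
    using B(1) that by (auto simp: orthogonal_def e0_def inner_one S_def)
  define B0 where "B0 = insert e0 B"
  have B0: "pairwise orthogonal B0" "\<And>b. b \<in> B0 \<Longrightarrow> norm b = 1" "\<And>b. b \<in> B0 \<Longrightarrow> \<exists>c. lap b = c *\<^sub>R b"
    using B orth0 e0 by (auto simp: B0_def pairwise_insert orthogonal_commute intro: exI[of _ 0])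
  have e0B: "e0 \<notin> B" using orth0[of e0] e0(1) by (auto simp: orthogonal_def)
  have ind: "independent B0"
    using B0(1) B0(2)[of 0] by (intro pairwise_orthogonal_independent) auto
  have "span B0 = UNIV"
  proof -
    have "x \<in> span B0" for x
    proof -
      have "x - mean x *\<^sub>R 1 \<in> span B" by (simp add: B(3) S_def mean_linear_simps)
      moreover have "mean x *\<^sub>R 1 = (mean x * norm (1::real^'n)) *\<^sub>R e0"
        using n1 by (simp add: e0_def)
      ultimately show ?thesis unfolding B0_def span_insert by auto
    qed
    then show ?thesis by blast
  qed
  then have "card B0 = CARD('n)"
    using dim_eq_card[of B0 UNIV] ind by simp
  moreover have fin: "finite B0" using ind independent_imp_finite by blast
  ultimately obtain e where e: "bij_betw e (UNIV :: 'n set) B0"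
    by (metis finite_same_card_bij finite)
  define g where "g b = (SOME c. lap b = c *\<^sub>R b)" for b
  have g: "lap b = g b *\<^sub>R b" if "b \<in> B0" for b
    unfolding g_def using someI_ex[OF B0(3)[OF that]] .
  have g_nonneg: "g b \<ge> 0" if "b \<in> B0" for b
    using lap_psd[of b] g[OF that] B0(2)[OF that] by (simp add: norm_eq_1)
  have ge0: "g e0 = 0"
    using g[of e0] e0 by (auto simp: B0_def)
  have eB: "e i \<in> B0" for i using e by (auto simp: bij_betw_def)
  have "e0 \<in> range e" using e by (simp add: bij_betw_def B0_def)
  then obtain m where m: "e m = e0" by auto
  have img: "e ` (- {m}) = B"
    using e e0B m by (auto simp: bij_betw_def B0_def inj_def Compl_eq_Diff_UNIV image_set_diff)
  have "gap = Min ((\<lambda>i. (real V - g (e m)) - (real V - g (e i))) ` (- {m}))"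
  proof (rule spectral_gap_orthonormal_eigenbasis)
    show "nbhd_matrix E *v e i = (real V - g (e i)) *\<^sub>R e i" for i
      using g[OF eB[of i]] by (simp add: lap_matrix algebra_simps)
    show "orthogonal (e i) (e j)" if "i \<noteq> j" for i j
      using that B0(1) eB e unfolding pairwise_def bij_betw_def inj_def by blast
    show "norm (e i) = 1" for i using eB B0(2) by blast
    show "real V - g (e i) \<le> real V - g (e m)" for i
      using g_nonneg[OF eB[of i]] by (simp add: m ge0)
  qed
  also have "\<dots> = Min (g ` B)"
    by (simp add: m ge0 flip: img add: image_image)
  finally have gap: "gap = Min (g ` B)" .
  \<comment> \<open>With at least two vertices the space of mean-zero vectors is nontrivial, so the
    minimum is over a nonempty set.\<close>
  have "B \<noteq> {}"
  proof
    assume "B = {}"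
    then have "card B0 \<le> 1" by (simp add: B0_def)
    then show False using two_vertices \<open>card B0 = _\<close> by simp
  qed
  moreover have "finite B" using fin by (simp add: B0_def)
  ultimately have "Min (g ` B) \<in> g ` B" and 2: "\<And>b. b \<in> B \<Longrightarrow> gap \<le> g b"
    unfolding gap by (auto intro: Min_in)
  then have 1: "\<exists>b\<in>B. g b = gap" by (auto simp: gap)
  then have "gap \<ge> 0" using g_nonneg by (force simp: B0_def)
  then show ?thesis
    using that[of B g] B g 1 2 \<open>finite B\<close> by (auto simp: S_def B0_def)
qed

lemma lap_norm_lower_bound: "mean x = 0 \<Longrightarrow> gap * norm x \<le> norm (lap x)"
proof (rule laplacian_eigenbasis, goal_cases)
  case (1 B g)
  then show ?thesis
    by (intro diagonalizable_norm_lower_bound[OF linear_lap, of B g]) force+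
qed

section \<open>Linearisation at the diagonal\<close>

lemma nsum_one [simp]: "nsum 1 i = real V"
  by (simp add: nsum_def regular)

lemma has_derivative_nsum [derivative_intros]:
  "(f has_derivative f') Fl \<Longrightarrow> ((\<lambda>x. nsum (f x) i) has_derivative (\<lambda>h. nsum (f' h) i)) Fl"
  unfolding nsum_def
  by (intro has_derivative_sum bounded_linear.has_derivative[OF bounded_linear_vec_nth])

lemma phi_nth: "phi E x $ i = x $ i / nsum x i"
  by (simp add: phi_def nsum_def)

lemma F_nth: "F lam E x $ i = lam - x $ i * exp (- nsum x i)"
  by (simp add: F_def nsum_def)

text \<open>Both this differential and that of \<open>F lam E\<close> at \<open>phi E 1\<close> are
  multiples of \<open>lap\<close>. Their composition produces the squared Laplacian, and so the
  squared gap in the threshold.\<close>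

lemma has_derivative_phi_one: "(phi E has_derivative (\<lambda>h. lap h /\<^sub>R (real V)\<^sup>2)) (at 1)"
proof (rule has_derivative_vecI)
  fix i
  have "((\<lambda>x. x $ i / nsum x i) has_derivative
      (\<lambda>h. (h $ i * nsum 1 i - 1 $ i * nsum h i) / (nsum 1 i * nsum 1 i))) (at 1)"
    using V_pos by (intro has_derivative_divide' derivative_intros
        bounded_linear.has_derivative[OF bounded_linear_vec_nth]) auto
  then show "((\<lambda>x. phi E x $ i) has_derivative (\<lambda>h. (lap h /\<^sub>R (real V)\<^sup>2) $ i)) (at 1)"
    using V_pos by (simp add: phi_nth lap_def field_simps power2_eq_square)
qed

lemma phi_one: "phi E 1 = (\<chi> i. 1 / real V)"
  by (simp add: vec_eq_iff phi_nth)

lemma has_derivative_F_phi_one: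
  "(F lam E has_derivative (\<lambda>h. (- (exp (-1) / real V)) *\<^sub>R lap h)) (at (phi E 1))"
proof (rule has_derivative_vecI)
  fix i
  have n: "nsum (phi E 1) i = 1" using V_pos by (simp add: nsum_def phi_one regular)
  have "((\<lambda>x. lam - x $ i * exp (- nsum x i)) has_derivative
      (\<lambda>h. 0 - (phi E 1 $ i * (- nsum h i * exp (- nsum (phi E 1) i))
             + h $ i * exp (- nsum (phi E 1) i)))) (at (phi E 1))"
    by (intro derivative_intros bounded_linear.has_derivative[OF bounded_linear_vec_nth])
  then show "((\<lambda>x. F lam E x $ i) has_derivative (\<lambda>h. ((- (exp (-1) / real V)) *\<^sub>R lap h) $ i)) (at (phi E 1))"
    unfolding n using V_pos by (simp add: F_nth phi_nth lap_def field_simps)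
qed

lemma field_one: "field 1 = growth *\<^sub>R 1"
  using V_pos by (simp add: vec_eq_iff field_def F_nth nsum_def phi_one regular growth_def)

lemma has_derivative_field_one: "(field has_derivative (\<lambda>h. (- coupling) *\<^sub>R lap (lap h))) (at 1)"
proof -
  interpret L: linear lap by (rule linear_lap)
  have "(F lam E \<circ> phi E has_derivative
      (\<lambda>h. (- (exp (-1) / real V)) *\<^sub>R lap h) \<circ> (\<lambda>h. lap h /\<^sub>R (real V)\<^sup>2)) (at 1)"
    by (rule diff_chain_at[OF has_derivative_phi_one has_derivative_F_phi_one])
  moreover have deriv: "(\<lambda>h. (- (exp (-1) / real V)) *\<^sub>R lap h) \<circ> (\<lambda>h. lap h /\<^sub>R (real V)\<^sup>2)
      = (\<lambda>h. (- coupling) *\<^sub>R lap (lap h))"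
    by (simp add: fun_eq_iff L.scale coupling_def power2_eq_square power3_eq_cube divide_inverse)
  moreover have "F lam E \<circ> phi E = field"
    by (simp add: fun_eq_iff field_def)
  ultimately show ?thesis by (simp only:)
qed

text \<open>The derivative of the mean drops out because Laplacians have mean zero; of the
  subtracted product only \<open>mean (field 1) = growth\<close> times \<open>h\<close>
  survives.\<close>

lemma has_derivative_drift_zero:
  "(drift has_derivative (\<lambda>h. - (growth *\<^sub>R h + coupling *\<^sub>R lap (lap h)))) (at 0)"
proof -
  have f: "((\<lambda>x. field (1 + x)) has_derivative (\<lambda>h. (- coupling) *\<^sub>R lap (lap h))) (at 0)"
    by (rule has_derivative_compose[where f="\<lambda>x. 1 + x" and f'="\<lambda>h. h" and x=0, simplified])
      (auto intro!: derivative_eq_intros has_derivative_field_one[simplified])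
  have m: "((\<lambda>x. mean (field (1 + x))) has_derivative (\<lambda>h. mean ((- coupling) *\<^sub>R lap (lap h)))) (at 0)"
    by (rule bounded_linear.has_derivative[OF bounded_linear_mean f])
  have m0: "mean ((- coupling) *\<^sub>R lap (lap h)) = 0" for h
    by (simp only: mean_linear_simps mean_lap) simp
  have "(drift has_derivative (\<lambda>h. (- coupling) *\<^sub>R lap (lap h)
      - (mean (field (1 + 0)) *\<^sub>R h + mean ((- coupling) *\<^sub>R lap (lap h)) *\<^sub>R (1 + 0)))) (at 0)"
    unfolding drift_def[abs_def]
    by (intro has_derivative_diff f has_derivative_scaleR m) (auto intro!: derivative_eq_intros)
  then show ?thesis
    unfolding m0 by (rule has_derivative_eq_rhs)
      (simp add: fun_eq_iff mean_linear_simps field_one algebra_simps)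
qed

lemma drift_approx:
  assumes "\<eta> > 0"
  obtains \<rho> where "\<rho> > 0"
    "\<And>x. norm x < \<rho> \<Longrightarrow> norm (drift x + (growth *\<^sub>R x + coupling *\<^sub>R lap (lap x))) \<le> \<eta> * norm x"
proof -
  have "drift 0 = 0" by (simp add: drift_def field_one mean_linear_simps)
  then show ?thesis
    using has_derivative_drift_zero[unfolded has_derivative_within_alt, THEN conjunct2, rule_format, OF assms]
      that by (auto simp: algebra_simps)
qed

section \<open>Homogeneity, bounds and regularity of the field\<close>

lemma nsum_scaleR: "nsum (r *\<^sub>R x) i = r * nsum x i"
  by (simp add: nsum_def sum_distrib_left)

lemma nsum_ge_nth: "(\<And>i. x $ i \<ge> 0) \<Longrightarrow> x $ i \<le> nsum x i"
  unfolding nsum_def by (rule member_le_sum) (auto simp: nbhd_def)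

lemma nsum_pos: "x \<in> H \<Longrightarrow> nsum x i > 0"
  using nsum_ge_nth[of x i] less_le_trans by (auto simp: H_def less_imp_le)

lemma phi_scaleR: "r \<noteq> 0 \<Longrightarrow> phi E (r *\<^sub>R x) = phi E x"
  by (simp add: vec_eq_iff phi_nth nsum_scaleR)

lemma phi_one_plus_dev: "x \<in> H \<Longrightarrow> phi E (1 + dev x) = phi E x"
  using phi_scaleR[of "mean x" "1 + dev x"] mean_pos[of x] by (simp add: mean_scaleR_one_plus_dev)

lemma field_one_plus_dev: "x \<in> H \<Longrightarrow> field (1 + dev x) = field x"
  by (simp add: field_def phi_one_plus_dev)

lemma phi_bounds: "x \<in> H \<Longrightarrow> 0 < phi E x $ i \<and> phi E x $ i \<le> 1"
  using nsum_pos[of x i] nsum_ge_nth[of x i] by (auto simp: phi_nth H_def less_imp_le)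

lemma field_bounds:
  assumes "x \<in> H"
  shows "lam - 1 \<le> field x $ i" "field x $ i \<le> lam"
proof -
  let ?p = "phi E x"
  have p: "0 \<le> ?p $ j" "?p $ j \<le> 1" for j using phi_bounds[OF assms, of j] by auto
  have "?p $ i * exp (- nsum ?p i) \<le> 1 * 1"
    using p by (intro mult_mono) (auto simp: nsum_def sum_nonneg)
  then show "lam - 1 \<le> field x $ i" by (simp add: field_def F_nth)
  show "field x $ i \<le> lam" using p[of i] by (simp add: field_def F_nth)
qed

text \<open>Each bound has its own use for the mean r of a solution: the lower one makes
  \<open>1 + r'\<close> nonnegative in the instability estimate, the upper one gives at most linear
  growth of r, and the absolute one fixes the power of r that bounds the deviation when the lifetime
  is finite.\<close>

lemma mean_field_bounds:
  assumes "x \<in> H"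
  shows "- 1 \<le> mean (field x)" "mean (field x) \<le> lam" "\<bar>mean (field x)\<bar> \<le> lam + 1"
proof -
  have "real CARD('n) * (lam - 1) \<le> (\<Sum>i\<in>UNIV. field x $ i)"
    using sum_bounded_below[of UNIV "lam - 1" "\<lambda>i. field x $ i"] field_bounds[OF assms] by simp
  then have "lam - 1 \<le> mean (field x)" by (simp add: mean_def field_simps)
  moreover have "(\<Sum>i\<in>UNIV. field x $ i) \<le> real CARD('n) * lam"
    using sum_bounded_above[of UNIV "\<lambda>i. field x $ i" lam] field_bounds[OF assms] by simp
  then show "mean (field x) \<le> lam" by (simp add: mean_def field_simps)
  ultimately show "- 1 \<le> mean (field x)" "\<bar>mean (field x)\<bar> \<le> lam + 1"
    using lam_pos by auto
qed

lemma norm_field_le: "x \<in> H \<Longrightarrow> norm (field x) \<le> real CARD('n) * (lam + 1)"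
proof -
  assume x: "x \<in> H"
  have le: "norm (field x) \<le> (\<Sum>i\<in>UNIV. \<bar>field x $ i\<bar>)" by (rule norm_le_l1_cart)
  have "\<bar>field x $ i\<bar> \<le> lam + 1" for i
    using field_bounds[OF x, of i] lam_pos by linarith
  then have "(\<Sum>i\<in>UNIV. \<bar>field x $ i\<bar>) \<le> real CARD('n) * (lam + 1)"
    using sum_bounded_above[of UNIV "\<lambda>i. \<bar>field x $ i\<bar>" "lam + 1"] by simp
  with le show ?thesis by linarith
qed

text \<open>On a compact subset of \<open>H\<close> the denominators \<open>nsum x i\<close> are
  bounded away from 0 and the exponents are nonpositive, so the closure rules for Lipschitz
  functions apply.\<close>

lemma field_lipschitz:
  assumes S: "compact S" "S \<subseteq> H"
  shows "\<exists>L. L-lipschitz_on S field"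
proof -
  have sum_lip: "\<exists>L. L-lipschitz_on S (\<lambda>x. \<Sum>j\<in>A. f x $ j)"
    if "\<And>j. \<exists>L. L-lipschitz_on S (\<lambda>x. f x $ j)" "finite A" for f :: "_ \<Rightarrow> real^'n" and A
    using that(2)
  proof induction
    case empty
    show ?case using lipschitz_on_constant by auto
  next
    case (insert j A)
    then show ?case
      using that(1)[of j] by (auto intro: lipschitz_on_add)
  qed
  have nth: "\<exists>L. L-lipschitz_on S (\<lambda>x. x $ i)" for i :: 'n
    by (intro exI[of _ 1] lipschitz_onI) (auto simp: dist_vec_nth_le)
  have phi: "\<exists>L. L-lipschitz_on S (\<lambda>x. phi E x $ i)" for i
    unfolding phi_nth divide_inverse
    using nsum_pos S(2)
    by (intro ex_lipschitz_on_mult ex_lipschitz_on_inverse S(1) nth)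
      (auto simp: nsum_def intro!: sum_lip nth)
  have "\<exists>L. L-lipschitz_on S (\<lambda>x. - nsum (phi E x) i)" for i
    using sum_lip[of "phi E" "nbhd E i"] phi by (auto simp: nsum_def)
  moreover have "nsum (phi E x) i \<ge> 0" if "x \<in> S" for x i
    using phi_bounds S(2) that by (auto simp: nsum_def less_imp_le intro!: sum_nonneg)
  ultimately have "\<exists>L. L-lipschitz_on S (\<lambda>x. phi E x $ i * exp (- nsum (phi E x) i))" for i
    by (intro ex_lipschitz_on_mult ex_lipschitz_on_exp S(1) phi) auto
  then have "\<exists>L. L-lipschitz_on S (\<lambda>x. field x $ i)" for i
    unfolding field_def F_nth using lipschitz_on_diff[OF lipschitz_on_constant] by blast
  then show ?thesis by (rule ex_lipschitz_on_vec)
qed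

lemma continuous_on_field: "continuous_on H field"
proof -
  have "continuous (at x) field" if x: "x \<in> H" for x
  proof -
    obtain d where d: "d > 0" "cball x d \<subseteq> H"
      using open_H x open_contains_cball by blast
    obtain L where "L-lipschitz_on (cball x d) field"
      using field_lipschitz[OF compact_cball d(2)] by blast
    then have "continuous_on (ball x d) field"
      using continuous_on_subset[OF lipschitz_on_continuous_on ball_subset_cball] by auto
    then show ?thesis
      using d by (simp add: continuous_on_eq_continuous_at)
  qed
  then show ?thesis by (simp add: continuous_at_imp_continuous_on)
qed

section \<open>Equations along a solution, and continuation\<close>

lemma solution_onD:
  assumes "solution_on lam E I z" "t \<in> I"
  shows "z t \<in> H" "(z has_vector_derivative field (z t)) (at t within I)"
  using assms by (auto simp: solution_on_def field_def)

lemma solution_on_subset: "solution_on lam E I z \<Longrightarrow> J \<subseteq> I \<Longrightarrow> solution_on lam E J z"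
  unfolding solution_on_def by (meson has_vector_derivative_within_subset subsetD)

lemma mean_solution_deriv:
  assumes "solution_on lam E I z" "t \<in> I"
  shows "((\<lambda>t. mean (z t)) has_real_derivative mean (field (z t))) (at t within I)"
  unfolding has_real_derivative_iff_has_vector_derivative
  using solution_onD(2)[OF assms] by (rule bounded_linear.has_vector_derivative[OF bounded_linear_mean])

text \<open>Quotient rule for \<open>z / r\<close>, where homogeneity turns
  \<open>field (z t)\<close> into \<open>field (1 + dev (z t))\<close>. Up to the factor
  \<open>1 / r\<close>, a change of time, the deviation obeys an autonomous equation.\<close>

lemma dev_solution_deriv:
  assumes "solution_on lam E I z" "t \<in> I"
  shows "((\<lambda>t. dev (z t)) has_vector_derivative drift (dev (z t)) /\<^sub>R mean (z t)) (at t within I)"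
proof -
  note z = solution_onD[OF assms]
  let ?r = "mean (z t)" and ?w = "1 + dev (z t)" and ?G = "field (z t)"
  have r: "?r > 0" using mean_pos z by blast
  have "((\<lambda>t. inverse (mean (z t)) *\<^sub>R z t - 1) has_vector_derivative
      inverse ?r *\<^sub>R ?G + (- (mean ?G * inverse (?r ^ Suc (Suc 0)))) *\<^sub>R z t - 0) (at t within I)"
    using r by (intro has_vector_derivative_diff has_vector_derivative_const
        has_vector_derivative_scaleR DERIV_inverse_fun mean_solution_deriv assms z) auto
  moreover have "inverse ?r *\<^sub>R ?G + (- (mean ?G * inverse (?r ^ Suc (Suc 0)))) *\<^sub>R z t - 0
      = drift (dev (z t)) /\<^sub>R ?r"
    using r by (simp add: drift_def field_one_plus_dev z) (simp add: dev_def algebra_simps)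
  ultimately show ?thesis by (simp add: dev_def[abs_def])
qed

text \<open>Used with the identity for N and with \<open>p\<^sup>2 - L\<^sup>2\<close> for the
  Chetaev function Q.\<close>

lemma quadratic_solution_deriv:
  assumes "solution_on lam E I z" "t \<in> I"
    and T: "bounded_linear T" and sa: "\<And>x y. T x \<bullet> y = x \<bullet> T y"
  shows "((\<lambda>t. dev (z t) \<bullet> T (dev (z t))) has_real_derivative
      2 * (T (dev (z t)) \<bullet> drift (dev (z t))) / mean (z t)) (at t within I)"
proof -
  interpret T: bounded_linear T by (rule T)
  note d = dev_solution_deriv[OF assms(1,2)]
  have "dev (z t) \<bullet> T (drift (dev (z t)) /\<^sub>R mean (z t)) + (drift (dev (z t)) /\<^sub>R mean (z t)) \<bullet> T (dev (z t))
      = 2 * (T (dev (z t)) \<bullet> drift (dev (z t))) / mean (z t)"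
    using sa[of "dev (z t)" "drift (dev (z t))"] inner_commute[of "drift (dev (z t))" "T (dev (z t))"]
    by (simp add: T.scaleR divide_inverse)
  with bounded_bilinear.has_vector_derivative[OF bounded_bilinear_inner d T.has_vector_derivative[OF d]]
  show ?thesis
    by (simp add: has_real_derivative_iff_has_vector_derivative)
qed

text \<open>\<open>g\<close> extends the solution continuously to the closed interval. A local
  solution started at \<open>g T\<close> is attached to it, so a solution with a limit in
  \<open>H\<close> is never maximal.\<close>

lemma solution_extends:
  assumes sol: "solution_on lam E {0..<T} z" and T: "T > 0"
    and g: "continuous_on {0..T} g" "\<And>t. t \<in> {0..<T} \<Longrightarrow> g t = z t" "g T \<in> H"
  shows "\<exists>T'>T. \<exists>w. solution_on lam E {0..<T'} w \<and> (\<forall>t\<in>{0..<T}. w t = z t)"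
proof -
  obtain d where d: "d > 0" "cball (g T) d \<subseteq> H"
    using open_H g(3) open_contains_cball by blast
  obtain L where L: "L-lipschitz_on (cball (g T) d) field"
    using field_lipschitz[OF compact_cball d(2)] by blast
  have "g T \<in> cball (g T) d" using d by simp
  from lipschitz_on_compact_ode_solution[OF compact_cball convex_cball this L]
  obtain x where x: "x 0 = g T" "continuous_on {0..} x"
    "\<And>t. t \<ge> 0 \<Longrightarrow> x t \<in> cball (g T) d \<Longrightarrow> (x has_vector_derivative field (x t)) (at t within {0..})"
    by blast
  obtain h where h: "h > 0" "\<And>s. 0 \<le> s \<Longrightarrow> s < h \<Longrightarrow> x s \<in> cball (g T) d"
  proof -
    obtain h where "h > 0" "\<forall>s\<in>{0..}. dist s 0 < h \<longrightarrow> dist (x s) (x 0) < d"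
      using x(2) d(1) unfolding continuous_on_iff by (metis atLeast_iff order_refl)
    then show ?thesis
      using that[of h] x(1) by (auto simp: dist_real_def dist_commute less_imp_le)
  qed
  define w where "w t = (if t \<le> T then g t else x (t - T))" for t
  have wH: "w t \<in> H" if "t \<in> {0..<T + h}" for t
    using that g(2,3) h(2)[of "t - T"] d(2) solution_onD(1)[OF sol]
    by (cases "t < T"; cases "t = T") (auto simp: w_def)
  have contw: "continuous_on {0..<T + h} w"
    unfolding w_def
  proof (rule continuous_on_cases_le)
    show "continuous_on {t \<in> {0..<T + h}. t \<le> T} g"
      using g(1) by (rule continuous_on_subset) auto
    have "continuous_on {t \<in> {0..<T + h}. T \<le> t} (x \<circ> (\<lambda>t. t - T))"
      by (rule continuous_on_compose) (auto intro!: continuous_intros continuous_on_subset[OF x(2)])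
    then show "continuous_on {t \<in> {0..<T + h}. T \<le> t} (\<lambda>t. x (t - T))" by (simp add: o_def)
  qed (auto simp: x(1) intro!: continuous_intros)
  have contf: "continuous_on {0..<T + h} (\<lambda>t. field (w t))"
    using continuous_on_compose2[OF continuous_on_field contw] wH by blast
  have der: "(w has_vector_derivative field (w t)) (at t)" if t: "0 < t" "t < T + h" "t \<noteq> T" for t
  proof (cases "t < T")
    case True
    have "at t within {0..<T} = at t"
      by (rule at_within_open_subset[of _ "{0<..<T}"]) (use t True in auto)
    then have "(z has_vector_derivative field (z t)) (at t)"
      using solution_onD(2)[OF sol, of t] t True by simp
    then have "(w has_vector_derivative field (z t)) (at t)"
      by (rule has_vector_derivative_transform_within_open[of _ _ _ "{0<..<T}"])
        (use t True g(2) in \<open>auto simp: w_def\<close>)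
    then show ?thesis using True t g(2) by (simp add: w_def)
  next
    case False
    have "at (t - T) within {0..} = at (t - T)"
      by (rule at_within_open_subset[of _ "{0<..}"]) (use t False in auto)
    then have "(x has_vector_derivative field (x (t - T))) (at (t - T))"
      using x(3)[of "t - T"] h(2)[of "t - T"] t False by simp
    then have "(x \<circ> (\<lambda>t. t - T) has_vector_derivative 1 *\<^sub>R field (x (t - T))) (at t)"
      by (intro vector_diff_chain_at) (auto intro!: derivative_eq_intros)
    then have "((\<lambda>t. x (t - T)) has_vector_derivative field (x (t - T))) (at t)"
      by (simp add: o_def)
    then have "(w has_vector_derivative field (x (t - T))) (at t)"
      by (rule has_vector_derivative_transform_within_open[of _ _ _ "{T<..}"])
        (use t False in \<open>auto simp: w_def\<close>)
    then show ?thesis using False t by (simp add: w_def)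
  qed
  \<comment> \<open>Instead of matching one-sided derivatives at \<open>T\<close>, pass to the
    integral equation: the single exceptional point \<open>T\<close> is harmless there, and
    continuity of the integrand returns the derivative everywhere.\<close>
  have int: "w t = w 0 + integral {0..t} (\<lambda>t. field (w t))" if "t \<in> {0..<T + h}" for t
  proof -
    have "((\<lambda>t. field (w t)) has_integral (w t - w 0)) {0..t}"
      using that der
      by (intro fundamental_theorem_of_calculus_interior_strong[of "{T}"])
        (auto intro: continuous_on_subset[OF contw])
    then show ?thesis by (simp add: integral_unique)
  qed
  have "(w has_vector_derivative field (w t)) (at t within {0..<T + h})" if t: "t \<in> {0..<T + h}" for t
  proof -
    obtain b where b: "t < b" "b < T + h" using t dense[of t "T + h"] by auto
    have "((\<lambda>u. w 0 + integral {0..u} (\<lambda>t. field (w t))) has_vector_derivative 0 + field (w t)) (at t within {0..b})"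
      using b t by (intro has_vector_derivative_add has_vector_derivative_const integral_has_vector_derivative)
        (auto intro: continuous_on_subset[OF contf])
    then have "(w has_vector_derivative 0 + field (w t)) (at t within {0..b})"
    proof (rule has_vector_derivative_transform[rotated 2])
      show "w u = w 0 + integral {0..u} (\<lambda>t. field (w t))" if "u \<in> {0..b}" for u
        by (rule int) (use that b in auto)
    qed (use b t in auto)
    moreover have "at t within {0..b} = at t within {0..<T + h}"
      using b t by (intro at_within_nhd[of _ "{..<b}"]) auto
    ultimately show ?thesis by simp
  qed
  then have "solution_on lam E {0..<T + h} w"
    using wH by (simp add: solution_on_def field_def)
  moreover have "\<forall>t\<in>{0..<T}. w t = z t" using g(2) by (simp add: w_def)
  ultimately show ?thesis using h(1) by (intro exI[of _ "T + h"]) auto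
qed

section \<open>Convergence\<close>

lemma dev_stays_small:
  assumes sol: "solution_on lam E {0..b} z" and b: "b \<ge> 0" and \<rho>: "\<rho> > 0"
    and drift: "\<And>x. mean x = 0 \<Longrightarrow> norm x \<le> \<rho> \<Longrightarrow> x \<bullet> drift x \<le> 0"
    and start: "norm (dev (z 0)) < \<rho>"
  shows "norm (dev (z b)) < \<rho>"
proof -
  have "dev (z b) \<bullet> dev (z b) < \<rho>\<^sup>2"
  proof (rule stays_below[OF b])
    show "((\<lambda>t. dev (z t) \<bullet> dev (z t)) has_real_derivative
        2 * (dev (z t) \<bullet> drift (dev (z t))) / mean (z t)) (at t within {0..b})" if "t \<in> {0..b}" for t
      using quadratic_solution_deriv[OF sol that bounded_linear_ident] by simp
    show "2 * (dev (z t) \<bullet> drift (dev (z t))) / mean (z t) \<le> 0"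
      if t: "t \<in> {0..b}" and "dev (z t) \<bullet> dev (z t) \<le> \<rho>\<^sup>2" for t
    proof -
      have "norm (dev (z t)) \<le> \<rho>"
        using that(2) \<rho> by (simp add: dot_square_norm power2_le_iff_abs_le)
      then have "dev (z t) \<bullet> drift (dev (z t)) \<le> 0"
        using drift[OF mean_dev] solution_onD(1)[OF sol t] by blast
      moreover have "mean (z t) > 0" using mean_pos solution_onD(1)[OF sol t] by blast
      ultimately show ?thesis by (simp add: divide_le_0_iff)
    qed
    show "dev (z 0) \<bullet> dev (z 0) < \<rho>\<^sup>2"
      using start by (simp add: dot_square_norm power_strict_mono)
  qed
  then show ?thesis
    using \<rho> by (simp add: dot_square_norm power2_less_imp_less)
qed

text \<open>\<open>q\<close> stands in for the integral of \<open>\<mu> / r\<close>: as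
  \<open>q' \<le> \<mu> / r\<close>, the product of the squared deviation with \<open>exp q\<close>
  does not increase. Keeping \<open>q\<close> general lets infinite and finite lifetimes share the
  estimate.\<close>

lemma dev_decay:
  assumes sol: "solution_on lam E {0..b} z" and b: "b \<ge> 0"
    and drift: "\<And>t. t \<in> {0..b} \<Longrightarrow> dev (z t) \<bullet> drift (dev (z t)) \<le> - (\<mu> / 2) * (dev (z t) \<bullet> dev (z t))"
    and q: "\<And>t. t \<in> {0..b} \<Longrightarrow> (q has_real_derivative q' t) (at t within {0..b})"
      "\<And>t. t \<in> {0..b} \<Longrightarrow> q' t * mean (z t) \<le> \<mu>"
  shows "(norm (dev (z b)))\<^sup>2 \<le> (norm (dev (z 0)))\<^sup>2 * exp (q 0 - q b)"
proof -
  let ?N = "\<lambda>t. dev (z t) \<bullet> dev (z t)"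
  have "?N b * exp (q b) \<le> ?N 0 * exp (q 0)"
  proof (rule has_real_derivative_nonpos_imp_le[OF b])
    fix t assume t: "t \<in> {0..b}"
    let ?N' = "2 * (dev (z t) \<bullet> drift (dev (z t))) / mean (z t)"
    have r: "mean (z t) > 0" using mean_pos solution_onD(1)[OF sol t] by blast
    have N: "(?N has_real_derivative ?N') (at t within {0..b})"
      using quadratic_solution_deriv[OF sol t bounded_linear_ident] by simp
    show "((\<lambda>t. ?N t * exp (q t)) has_real_derivative
        ?N' * exp (q t) + exp (q t) * q' t * ?N t) (at t within {0..b})"
      by (intro DERIV_mult N DERIV_chain2[OF DERIV_exp] q t)
    have "?N' * mean (z t) + q' t * mean (z t) * ?N t \<le> - \<mu> * ?N t + \<mu> * ?N t"
      using r drift[OF t] q(2)[OF t] by (intro add_mono mult_right_mono) auto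
    then have "(?N' + q' t * ?N t) * mean (z t) \<le> 0"
      by (simp add: algebra_simps)
    then have "?N' + q' t * ?N t \<le> 0"
      using r by (simp add: mult_le_0_iff)
    then have "exp (q t) * (?N' + q' t * ?N t) \<le> 0"
      by (simp add: mult_le_0_iff)
    then show "?N' * exp (q t) + exp (q t) * q' t * ?N t \<le> 0"
      by (simp add: algebra_simps)
  qed
  then show ?thesis
    by (simp add: dot_square_norm exp_diff field_simps)
qed

lemma phi_tendsto:
  assumes "\<forall>\<^sub>F t in Fl. z t \<in> H" and "((\<lambda>t. dev (z t)) \<longlongrightarrow> 0) Fl"
  shows "((\<lambda>t. phi E (z t)) \<longlongrightarrow> (\<chi> i. 1 / real V)) Fl"
proof -
  have "isCont (phi E) 1"
    using has_derivative_phi_one by (rule has_derivative_continuous)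
  moreover have "((\<lambda>t. 1 + dev (z t)) \<longlongrightarrow> 1) Fl"
    using tendsto_add[OF tendsto_const assms(2), of 1] by simp
  ultimately have "((\<lambda>t. phi E (1 + dev (z t))) \<longlongrightarrow> phi E 1) Fl"
    by (rule isCont_tendsto_compose)
  moreover have "\<forall>\<^sub>F t in Fl. phi E (1 + dev (z t)) = phi E (z t)"
    using assms(1) by eventually_elim (rule phi_one_plus_dev)
  ultimately show ?thesis
    by (simp add: phi_one tendsto_cong)
qed

text \<open>The field is bounded, so the solution is Lipschitz and extends to time \<open>T\<close>.
  If the limiting mean were positive, all coordinates of the limit would be at least half of it, and
  the solution could be continued.\<close>

lemma finite_maximal_mean_tendsto_0:
  assumes max: "finite_maximal_solution lam E T z"
    and small: "\<And>t. t \<in> {0..<T} \<Longrightarrow> norm (dev (z t)) \<le> 1/2"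
  shows "((\<lambda>t. mean (z t)) \<longlongrightarrow> 0) (at_left T)"
proof -
  have T: "T > 0" and sol: "solution_on lam E {0..<T} z"
    using max by (auto simp: finite_maximal_solution_def)
  define C where "C = real CARD('n) * (lam + 1)"
  have "C-lipschitz_on {0..<T} z"
  proof (rule lipschitz_onI)
    show "C \<ge> 0" using lam_pos by (simp add: C_def)
    fix s t assume st: "s \<in> {0..<T}" "t \<in> {0..<T}"
    have "norm (z s - z t) \<le> C * norm (s - t)"
    proof (rule differentiable_bound)
      show "convex {0..<T}" by simp
      show "(z has_derivative (\<lambda>h. h *\<^sub>R field (z u))) (at u within {0..<T})" if "u \<in> {0..<T}" for u
        using solution_onD(2)[OF sol that] by (simp add: has_vector_derivative_def)
      show "onorm (\<lambda>h. h *\<^sub>R field (z u)) \<le> C" if "u \<in> {0..<T}" for u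
        using norm_field_le[OF solution_onD(1)[OF sol that]] \<open>C \<ge> 0\<close>
        by (intro onorm_bound) (auto simp: C_def mult.commute intro: mult_left_mono)
    qed (use st in auto)
    then show "dist (z s) (z t) \<le> C * dist s t" by (simp add: dist_norm)
  qed
  then obtain g where "C-lipschitz_on (closure {0..<T}) g" and g: "\<And>t. t \<in> {0..<T} \<Longrightarrow> g t = z t"
    using lipschitz_extend_closure by blast
  then have "C-lipschitz_on {0..T} g" using T by simp
  then have contg: "continuous_on {0..T} g" by (rule lipschitz_on_continuous_on)
  have ev: "\<forall>\<^sub>F t in at_left T. t \<in> {0..<T}"
    using T by (auto simp: eventually_at_left intro!: exI[of _ 0])
  have "(g \<longlongrightarrow> g T) (at T within {0..T})"
    using contg T by (simp add: continuous_on)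
  then have "(g \<longlongrightarrow> g T) (at_left T)"
    using at_within_Icc_at_left[OF T] by simp
  then have zlim: "(z \<longlongrightarrow> g T) (at_left T)"
    by (rule Lim_transform_eventually) (use ev g in \<open>auto elim!: eventually_mono\<close>)
  then have mlim: "((\<lambda>t. mean (z t)) \<longlongrightarrow> mean (g T)) (at_left T)"
    by (rule bounded_linear.tendsto[OF bounded_linear_mean])
  have "\<forall>\<^sub>F t in at_left T. 0 \<le> mean (z t)"
    using ev by eventually_elim (rule less_imp_le[OF mean_pos[OF solution_onD(1)[OF sol]]])
  then have "mean (g T) \<ge> 0"
    by (rule tendsto_lowerbound[OF mlim]) simp
  moreover have "\<not> mean (g T) > 0"
  proof
    assume pos: "mean (g T) > 0"
    have le: "mean (g T) / 2 \<le> g T $ i" for i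
    proof (rule tendsto_le)
      show "((\<lambda>t. z t $ i) \<longlongrightarrow> g T $ i) (at_left T)" using zlim by (rule tendsto_vec_nth)
      show "((\<lambda>t. mean (z t) / 2) \<longlongrightarrow> mean (g T) / 2) (at_left T)" by (intro tendsto_intros mlim) simp
      show "\<forall>\<^sub>F t in at_left T. mean (z t) / 2 \<le> z t $ i"
        using ev by eventually_elim (rule nth_lower_bound[OF solution_onD(1)[OF sol] small])
    qed simp
    have "0 < g T $ i" for i using le[of i] pos by linarith
    then have "g T \<in> H" by (simp add: H_def)
    from solution_extends[OF sol T contg g this] max show False
      unfolding finite_maximal_solution_def by blast
  qed
  ultimately have "mean (g T) = 0" by simp
  with mlim show ?thesis by simp
qed

text \<open>By the spectral bound the linear part contributes decay at rate at least
  \<open>growth + coupling * gap\<^sup>2\<close>; the remainder of the linearisation is allowed half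
  of it.\<close>

lemma stable_drift:
  assumes \<mu>: "growth + coupling * gap\<^sup>2 > 0"
  obtains \<rho> where "0 < \<rho>" "\<rho> \<le> 1/2"
    "\<And>x. mean x = 0 \<Longrightarrow> norm x \<le> \<rho> \<Longrightarrow> x \<bullet> drift x \<le> - ((growth + coupling * gap\<^sup>2) / 2) * (x \<bullet> x)"
proof -
  let ?\<mu> = "growth + coupling * gap\<^sup>2"
  obtain \<rho> where \<rho>: "\<rho> > 0"
    "\<And>x. norm x < \<rho> \<Longrightarrow> norm (drift x + (growth *\<^sub>R x + coupling *\<^sub>R lap (lap x))) \<le> ?\<mu> / 2 * norm x"
    using drift_approx[of "?\<mu> / 2"] \<mu> by auto
  show ?thesis
  \<comment> \<open>Halving \<open>\<rho>\<close> turns the strict bound required by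
    \<open>drift_approx\<close> into a weak one; the bound 1/2 is what
    \<open>nth_lower_bound\<close> requires.\<close>
  proof (rule that[of "min (\<rho> / 2) (1/2)"])
    fix x :: "real^'n" assume x: "mean x = 0" "norm x \<le> min (\<rho> / 2) (1/2)"
    let ?M = "growth *\<^sub>R x + coupling *\<^sub>R lap (lap x)"
    have gap: "gap \<ge> 0" by (rule laplacian_eigenbasis)
    have "(gap * norm x)\<^sup>2 \<le> (norm (lap x))\<^sup>2"
      using lap_norm_lower_bound[OF x(1)] gap by (intro power_mono) auto
    then have "coupling * (gap\<^sup>2 * (x \<bullet> x)) \<le> coupling * (lap x \<bullet> lap x)"
      using coupling_pos by (intro mult_left_mono) (auto simp: dot_square_norm power_mult_distrib)
    then have "?\<mu> * (x \<bullet> x) \<le> x \<bullet> ?M"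
      using lap_selfadjoint[of x "lap x"] by (simp add: inner_add_right algebra_simps)
    moreover have "x \<bullet> (drift x + ?M) \<le> norm x * (?\<mu> / 2 * norm x)"
      using order_trans[OF norm_cauchy_schwarz mult_left_mono[OF \<rho>(2)[of x] norm_ge_zero[of x]]] x(2) \<rho>(1)
      by auto
    then have "x \<bullet> drift x + x \<bullet> ?M \<le> ?\<mu> / 2 * (x \<bullet> x)"
      by (simp add: inner_add_right dot_square_norm power2_eq_square algebra_simps)
    ultimately show "x \<bullet> drift x \<le> - (?\<mu> / 2) * (x \<bullet> x)"
      by (simp add: field_simps)
  qed (use \<rho> in auto)
qed

lemma phi_converges:
  assumes \<mu>: "growth + coupling * gap\<^sup>2 > 0"
  obtains u where "u > 0"
    "\<And>z. solution_on lam E {0..} z \<Longrightarrow> z 0 \<in> diag_cone u \<Longrightarrow>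
       ((\<lambda>t. phi E (z t)) \<longlongrightarrow> (\<chi> i. 1 / real V)) at_top"
    "\<And>T z. finite_maximal_solution lam E T z \<Longrightarrow> z 0 \<in> diag_cone u \<Longrightarrow>
       ((\<lambda>t. phi E (z t)) \<longlongrightarrow> (\<chi> i. 1 / real V)) (at_left T)"
proof -
  define \<mu> where "\<mu> = growth + coupling * gap\<^sup>2"
  have \<mu>_pos: "\<mu> > 0" using assms by (simp add: \<mu>_def)
  obtain \<rho> where \<rho>: "0 < \<rho>" "\<rho> \<le> 1/2"
    and drift: "\<And>x. mean x = 0 \<Longrightarrow> norm x \<le> \<rho> \<Longrightarrow> x \<bullet> drift x \<le> - (\<mu> / 2) * (x \<bullet> x)"
    using stable_drift[OF \<mu>] unfolding \<mu>_def by blast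
  have drift0: "x \<bullet> drift x \<le> 0" if "mean x = 0" "norm x \<le> \<rho>" for x
  proof -
    have "0 \<le> (\<mu> / 2) * (x \<bullet> x)" using \<mu>_pos by (intro mult_nonneg_nonneg) auto
    then show ?thesis using drift[OF that] by linarith
  qed
  define u where "u = \<rho> / (2 * real CARD('n))"
  have start: "norm (dev x) < \<rho>" if "x \<in> diag_cone u" for x :: "real^'n"
    using that norm_le_l1norm[of "dev x"] \<rho>(1) by (simp add: diag_cone_iff u_def)
  have small: "norm (dev (z b)) < \<rho>"
    if "solution_on lam E I z" "{0..b} \<subseteq> I" "b \<ge> 0" "z 0 \<in> diag_cone u" for I z b
    using dev_stays_small[OF solution_on_subset[OF that(1,2)] that(3) \<rho>(1) drift0 start[OF that(4)]] .
  have decay: "(norm (dev (z b)))\<^sup>2 \<le> (norm (dev (z 0)))\<^sup>2 * exp (q 0 - q b)"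
    if sol: "solution_on lam E I z" and b: "{0..b} \<subseteq> I" "b \<ge> 0" and z0: "z 0 \<in> diag_cone u"
      and q: "\<And>t. t \<in> I \<Longrightarrow> (q has_real_derivative q' t) (at t within I)"
        "\<And>t. t \<in> I \<Longrightarrow> q' t * mean (z t) \<le> \<mu>" for I z b q q'
  proof (rule dev_decay[OF solution_on_subset[OF sol b(1)] b(2)])
    fix t assume t: "t \<in> {0..b}"
    then have "norm (dev (z t)) < \<rho>" using b by (intro small[OF sol _ _ z0]) auto
    then show "dev (z t) \<bullet> drift (dev (z t)) \<le> - (\<mu> / 2) * (dev (z t) \<bullet> dev (z t))"
      using solution_onD(1)[OF sol] b t by (intro drift mean_dev) auto
    show "(q has_real_derivative q' t) (at t within {0..b})"
      using q(1)[of t] b(1) t by (meson DERIV_subset subsetD)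
    show "q' t * mean (z t) \<le> \<mu>" using q(2) b t by auto
  qed
  show ?thesis
  proof (rule that[of u])
    show "u > 0" using \<rho> by (simp add: u_def)
  next
    fix z assume sol: "solution_on lam E {0..} z" and z0: "z 0 \<in> diag_cone u"
    define r0 where "r0 = mean (z 0)"
    have r0: "r0 > 0" using mean_pos[OF solution_onD(1)[OF sol, of 0]] by (simp add: r0_def)
    have mean_le: "mean (z t) \<le> r0 + lam * t" if "t \<ge> 0" for t
    proof -
      have sol': "solution_on lam E {0..t} z" using sol by (rule solution_on_subset) auto
      have "mean (z t) - lam * t \<le> mean (z 0) - lam * 0"
      proof (rule has_real_derivative_nonpos_imp_le[OF that])
        show "((\<lambda>t. mean (z t) - lam * t) has_real_derivative mean (field (z s)) - lam) (at s within {0..t})"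
          if "s \<in> {0..t}" for s
          by (auto intro!: derivative_eq_intros mean_solution_deriv[OF sol' that])
        show "mean (field (z s)) - lam \<le> 0" if "s \<in> {0..t}" for s
          using mean_field_bounds(2)[OF solution_onD(1)[OF sol' that]] by simp
      qed
      then show ?thesis by (simp add: r0_def)
    qed
    \<comment> \<open>An antiderivative of \<open>\<mu> / (r0 + lam * t)\<close>, which is at most
      \<open>\<mu> / r\<close> by \<open>mean_le\<close>. It tends to infinity, which is the
      divergence of the integral of \<open>1 / r\<close>.\<close>
    define q where "q t = (\<mu> / lam) * ln (r0 + lam * t)" for t
    have pos: "r0 + lam * t > 0" if "t \<ge> 0" for t
      using r0 lam_pos that by (simp add: add_pos_nonneg)
    have "(norm (dev (z t)))\<^sup>2 \<le> (norm (dev (z 0)))\<^sup>2 * exp (q 0 - q t)" if t: "t \<ge> 0" for t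
    proof (rule decay[OF sol _ t z0])
      show "(q has_real_derivative (\<mu> / (r0 + lam * s))) (at s within {0..})" if "s \<in> {0..}" for s
        unfolding q_def using pos[of s] that lam_pos
        by (auto intro!: derivative_eq_intros)
      show "\<mu> / (r0 + lam * s) * mean (z s) \<le> \<mu>" if "s \<in> {0..}" for s
        using mult_left_mono[OF mean_le[of s] less_imp_le[OF \<mu>_pos]] pos[of s] that
        by (simp add: pos_divide_le_eq)
    qed auto
    moreover have "exp (q 0 - q t) = exp (q 0) * (r0 + lam * t) powr (- (\<mu> / lam))" if "t \<ge> 0" for t
    proof -
      have "(r0 + lam * t) powr (- (\<mu> / lam)) = exp (- q t)"
        using pos[OF that] by (simp add: powr_def q_def)
      then show ?thesis by (simp flip: exp_add)
    qed
    ultimately have "\<forall>\<^sub>F t in at_top. (norm (dev (z t)))\<^sup>2 \<le>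
        (norm (dev (z 0)))\<^sup>2 * (exp (q 0) * (r0 + lam * t) powr (- (\<mu> / lam)))"
      by (intro eventually_at_top_linorderI[of 0]) metis
    moreover have "filterlim (\<lambda>t. r0 + lam * t) at_top at_top"
      using lam_pos
      by (intro filterlim_tendsto_add_at_top[OF tendsto_const]
          filterlim_tendsto_pos_mult_at_top[OF tendsto_const] filterlim_ident)
    then have "((\<lambda>t. (norm (dev (z 0)))\<^sup>2 * (exp (q 0) * (r0 + lam * t) powr (- (\<mu> / lam)))) \<longlongrightarrow> 0) at_top"
      using \<mu>_pos lam_pos by (intro tendsto_mult_right_zero tendsto_neg_powr) auto
    ultimately have "((\<lambda>t. dev (z t)) \<longlongrightarrow> 0) at_top"
      by (rule tendsto_0_norm_square_bound)
    moreover have "\<forall>\<^sub>F t in at_top. z t \<in> H"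
      using solution_onD(1)[OF sol] by (intro eventually_at_top_linorderI[of 0]) auto
    ultimately show "((\<lambda>t. phi E (z t)) \<longlongrightarrow> (\<chi> i. 1 / real V)) at_top"
      by (intro phi_tendsto)
  next
    fix T z assume max: "finite_maximal_solution lam E T z" and z0: "z 0 \<in> diag_cone u"
    have T: "T > 0" and sol: "solution_on lam E {0..<T} z"
      using max by (auto simp: finite_maximal_solution_def)
    have mlim: "((\<lambda>t. mean (z t)) \<longlongrightarrow> 0) (at_left T)"
    proof (rule finite_maximal_mean_tendsto_0[OF max])
      fix t assume "t \<in> {0..<T}"
      then show "norm (dev (z t)) \<le> 1/2"
        using small[OF sol _ _ z0, of t] \<rho>(2) by force
    qed
    have pos: "mean (z t) > 0" if "t \<in> {0..<T}" for t
      using mean_pos solution_onD(1)[OF sol that] by blast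
    have ev: "\<forall>\<^sub>F t in at_left T. t \<in> {0..<T}"
      using T by (auto simp: eventually_at_left intro!: exI[of _ 0])
    \<comment> \<open>With \<open>q = - \<alpha> * ln r\<close> the condition on \<open>q'\<close>
      reads \<open>- \<alpha> * r' \<le> \<mu>\<close>, which this exponent guarantees because
      \<open>\<bar>r'\<bar> \<le> lam + 1\<close>. Then \<open>exp (- q)\<close> is \<open>r\<close>
      to the power \<open>\<alpha>\<close>.\<close>
    define \<alpha> where "\<alpha> = \<mu> / (lam + 1)"
    have \<alpha>: "\<alpha> > 0" using \<mu>_pos lam_pos by (simp add: \<alpha>_def)
    define q where "q t = - \<alpha> * ln (mean (z t))" for t
    have "(norm (dev (z t)))\<^sup>2 \<le> (norm (dev (z 0)))\<^sup>2 * exp (q 0 - q t)" if t: "t \<in> {0..<T}" for t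
    proof (rule decay[OF sol _ _ z0])
      show "(q has_real_derivative - \<alpha> * (mean (field (z s)) / mean (z s))) (at s within {0..<T})"
        if "s \<in> {0..<T}" for s
        unfolding q_def using pos[OF that]
        by (auto intro!: derivative_eq_intros mean_solution_deriv[OF sol that])
      show "- \<alpha> * (mean (field (z s)) / mean (z s)) * mean (z s) \<le> \<mu>" if "s \<in> {0..<T}" for s
      proof -
        have "- \<alpha> * (mean (field (z s)) / mean (z s)) * mean (z s) = \<alpha> * (- mean (field (z s)))"
          using pos[OF that] by simp
        also have "\<dots> \<le> \<alpha> * (lam + 1)"
          using mean_field_bounds(3)[OF solution_onD(1)[OF sol that]] \<alpha> by (intro mult_left_mono) auto
        also have "\<dots> = \<mu>" using lam_pos by (simp add: \<alpha>_def)
        finally show ?thesis .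
      qed
    qed (use t in auto)
    moreover have "exp (q 0 - q t) = exp (q 0) * mean (z t) powr \<alpha>" if "t \<in> {0..<T}" for t
    proof -
      have "mean (z t) powr \<alpha> = exp (- q t)"
        using pos[OF that] by (simp add: powr_def q_def)
      then show ?thesis by (simp flip: exp_add)
    qed
    ultimately have "\<forall>\<^sub>F t in at_left T. (norm (dev (z t)))\<^sup>2 \<le>
        (norm (dev (z 0)))\<^sup>2 * (exp (q 0) * mean (z t) powr \<alpha>)"
      by (intro eventually_mono[OF ev]) metis
    moreover have "((\<lambda>t. (norm (dev (z 0)))\<^sup>2 * (exp (q 0) * mean (z t) powr \<alpha>)) \<longlongrightarrow> 0) (at_left T)"
      using ev \<alpha> pos
      by (intro tendsto_mult_right_zero tendsto_zero_powrI[OF mlim tendsto_const])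
        (auto elim!: eventually_mono simp: less_imp_le)
    ultimately have "((\<lambda>t. dev (z t)) \<longlongrightarrow> 0) (at_left T)"
      by (rule tendsto_0_norm_square_bound)
    moreover have "\<forall>\<^sub>F t in at_left T. z t \<in> H"
      using ev solution_onD(1)[OF sol] by (auto elim!: eventually_mono)
    ultimately show "((\<lambda>t. phi E (z t)) \<longlongrightarrow> (\<chi> i. 1 / real V)) (at_left T)"
      by (intro phi_tendsto)
  qed
qed

section \<open>Instability\<close>

text \<open>With \<open>T = p\<^sup>2 - L\<^sup>2\<close> the linear part of the drift is
  \<open>\<sigma> x + k T x\<close>. Pairing with \<open>T x\<close> gives
  \<open>\<sigma> (x \<bullet> T x)\<close> plus k times the square of \<open>norm (T x)\<close>,
  and the latter absorbs the nonlinear remainder because \<open>T\<close> is injective on mean-zero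
  vectors.\<close>

lemma unstable_drift:
  assumes unstable: "growth + coupling * gap\<^sup>2 < 0"
  obtains T \<sigma> \<rho> M e where "bounded_linear T" "\<And>x y. T x \<bullet> y = x \<bullet> T y" "\<sigma> > 0" "0 < \<rho>" "\<rho> \<le> 1/2"
    "\<And>x. mean x = 0 \<Longrightarrow> norm x \<le> \<rho> \<Longrightarrow> \<sigma> * (x \<bullet> T x) \<le> T x \<bullet> drift x"
    "\<And>x. x \<bullet> T x \<le> M * (norm x)\<^sup>2" "M > 0" "mean e = 0" "e \<bullet> T e > 0"
    "\<And>x. norm x \<le> \<rho> \<Longrightarrow> mean (field (1 + x)) \<le> growth / 2"
proof -
  interpret L: linear lap by (rule linear_lap)
  obtain B g where B: "pairwise orthogonal B" "\<And>b. b \<in> B \<Longrightarrow> norm b = 1" "finite B"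
    "span B = {x. mean x = 0}" "\<And>b. b \<in> B \<Longrightarrow> lap b = g b *\<^sub>R b"
    "\<And>b. b \<in> B \<Longrightarrow> gap \<le> g b" "\<exists>b\<in>B. g b = gap" "gap \<ge> 0"
    using laplacian_eigenbasis by blast
  have "gap\<^sup>2 < - growth / coupling"
    using unstable coupling_pos by (simp add: field_simps)
  then have "gap < sqrt (- growth / coupling)" by (rule real_less_rsqrt)
  \<comment> \<open>The interval is nonempty by the instability hypothesis. Removing the finitely
    many eigenvalues leaves a \<open>p\<close> for which \<open>T\<close> has no kernel among
    mean-zero vectors.\<close>
  then have "infinite ({gap<..<sqrt (- growth / coupling)} - g ` B)"
    using B(3) by (intro Diff_infinite_finite) auto
  from infinite_imp_nonempty[OF this] obtain p
    where "p \<in> {gap<..<sqrt (- growth / coupling)} - g ` B" by blast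
  then have p: "gap < p" "p < sqrt (- growth / coupling)" "p \<notin> g ` B" by auto
  have p0: "p > 0" using p B(8) by linarith
  have "growth < 0"
  proof -
    have "0 \<le> coupling * gap\<^sup>2" using coupling_pos by simp
    then show ?thesis using unstable by linarith
  qed
  then have "- growth / coupling \<ge> 0" using coupling_pos by (intro divide_nonneg_pos) auto
  moreover have "p\<^sup>2 < (sqrt (- growth / coupling))\<^sup>2"
    using p p0 by (intro power_strict_mono) auto
  ultimately have p2: "p\<^sup>2 < - growth / coupling" by simp
  define T where "T x = p\<^sup>2 *\<^sub>R x - lap (lap x)" for x
  define \<sigma> where "\<sigma> = - growth - coupling * p\<^sup>2"
  have \<sigma>: "\<sigma> > 0" using p2 coupling_pos by (simp add: \<sigma>_def field_simps)
  have linT: "linear T"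
    unfolding T_def by (intro linearI) (simp_all add: L.add L.scale algebra_simps)
  have saT: "T x \<bullet> y = x \<bullet> T y" for x y
    by (simp only: T_def inner_diff_left inner_diff_right inner_scaleR_left inner_scaleR_right lap_selfadjoint)
  have Tb: "T b = (p\<^sup>2 - (g b)\<^sup>2) *\<^sub>R b" if "b \<in> B" for b
    using B(5)[OF that] by (simp add: T_def L.scale power2_eq_square algebra_simps)
  have QT: "x \<bullet> T x = p\<^sup>2 * (norm x)\<^sup>2 - (norm (lap x))\<^sup>2" for x
    using lap_selfadjoint[of x "lap x"] by (simp add: T_def inner_diff_right dot_square_norm)
  \<comment> \<open>The least modulus of an eigenvalue of \<open>T\<close> on mean-zero vectors. The
    tolerance \<open>coupling * \<kappa>\<close> for \<open>drift_approx\<close> then keeps the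
    remainder below \<open>coupling * norm (T x)\<close>.\<close>
  define \<kappa> where "\<kappa> = Min ((\<lambda>b. \<bar>p\<^sup>2 - (g b)\<^sup>2\<bar>) ` B)"
  have "B \<noteq> {}" using B(7) by blast
  then have "\<kappa> \<in> (\<lambda>b. \<bar>p\<^sup>2 - (g b)\<^sup>2\<bar>) ` B"
    unfolding \<kappa>_def using B(3) by (intro Min_in) auto
  then obtain b' where b': "b' \<in> B" "\<kappa> = \<bar>p\<^sup>2 - (g b')\<^sup>2\<bar>" by auto
  then have "p \<noteq> g b'" "g b' \<ge> 0" using p(3) B(6)[of b'] B(8) by auto
  then have "p\<^sup>2 \<noteq> (g b')\<^sup>2" using p0 by (simp add: power2_eq_iff_nonneg)
  then have \<kappa>: "\<kappa> > 0" using b' by simp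
  have T_lower: "\<kappa> * norm x \<le> norm (T x)" if "mean x = 0" for x
  proof (rule diagonalizable_norm_lower_bound[OF linT B(1,2,3) Tb less_imp_le[OF \<kappa>]])
    show "\<kappa> \<le> \<bar>p\<^sup>2 - (g b)\<^sup>2\<bar>" if "b \<in> B" for b
      unfolding \<kappa>_def using B(3) that by (intro Min_le) auto
    show "x \<in> span B" unfolding B(4) using that by simp
  qed
  obtain \<rho>1 where \<rho>1: "\<rho>1 > 0"
    "\<And>x. norm x < \<rho>1 \<Longrightarrow> norm (drift x + (growth *\<^sub>R x + coupling *\<^sub>R lap (lap x))) \<le> coupling * \<kappa> * norm x"
    using drift_approx[of "coupling * \<kappa>"] coupling_pos \<kappa> by auto
  have "isCont field 1"
    using has_derivative_field_one by (rule has_derivative_continuous)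
  then obtain \<rho>2 where \<rho>2: "\<rho>2 > 0" "\<And>y. dist y 1 < \<rho>2 \<Longrightarrow> dist (mean (field y)) (mean (field 1)) < - growth / 2"
    using \<open>growth < 0\<close> bounded_linear.continuous[OF bounded_linear_mean, of "at 1" field]
    unfolding continuous_at_eps_delta by (metis half_gt_zero neg_0_less_iff_less)
  \<comment> \<open>The Laplacian mode with the smallest eigenvalue is the unstable direction:
    \<open>T\<close> acts on it as the positive number
    \<open>p\<^sup>2 - gap\<^sup>2\<close>.\<close>
  obtain e where e: "e \<in> B" "g e = gap" using B(7) by blast
  define \<rho> where "\<rho> = min (1/2) (min (\<rho>1 / 2) (\<rho>2 / 2))"
  show ?thesis
  proof (rule that[of T \<sigma> \<rho> "p\<^sup>2" e])
    show "bounded_linear T" using linT by (simp add: linear_conv_bounded_linear)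
    show "T x \<bullet> y = x \<bullet> T y" for x y by (rule saT)
    show "0 < \<rho>" "\<rho> \<le> 1/2" using \<rho>1 \<rho>2 by (auto simp: \<rho>_def)
    show "mean e = 0" using e(1) B(4) span_base by blast
    show "e \<bullet> T e > 0"
      using Tb[OF e(1)] e(2) p(1) B(8) B(2)[OF e(1)] by (simp add: norm_eq_1 power_strict_mono)
    show "x \<bullet> T x \<le> p\<^sup>2 * (norm x)\<^sup>2" for x by (simp add: QT)
    show "mean (field (1 + x)) \<le> growth / 2" if "norm x \<le> \<rho>" for x
    proof -
      have "dist (1 + x) 1 < \<rho>2" using that \<rho>2(1) by (simp add: \<rho>_def dist_norm)
      from \<rho>2(2)[OF this] have "\<bar>mean (field (1 + x)) - growth\<bar> < - growth / 2"
        by (simp add: dist_real_def field_one mean_linear_simps)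
      then show ?thesis by linarith
    qed
    show "\<sigma> * (x \<bullet> T x) \<le> T x \<bullet> drift x" if x: "mean x = 0" "norm x \<le> \<rho>" for x
    proof -
      let ?err = "drift x + (growth *\<^sub>R x + coupling *\<^sub>R lap (lap x))"
      have "norm ?err \<le> coupling * (\<kappa> * norm x)"
        using \<rho>1(2)[of x] \<rho>1(1) x(2) by (simp add: \<rho>_def ac_simps)
      also have "\<dots> \<le> coupling * norm (T x)"
        using T_lower[OF x(1)] coupling_pos by (intro mult_left_mono) auto
      finally have "norm (T x) * norm ?err \<le> norm (T x) * (coupling * norm (T x))"
        by (intro mult_left_mono) auto
      moreover have "- (T x \<bullet> ?err) \<le> norm (T x) * norm ?err"
        using norm_cauchy_schwarz[of "- T x" ?err] by simp
      ultimately have "- (T x \<bullet> ?err) \<le> coupling * (T x \<bullet> T x)"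
        by (simp add: dot_square_norm power2_eq_square algebra_simps)
      moreover have "drift x = ?err + \<sigma> *\<^sub>R x + coupling *\<^sub>R T x"
        by (simp add: \<sigma>_def T_def algebra_simps)
      then have "T x \<bullet> drift x = T x \<bullet> (?err + \<sigma> *\<^sub>R x + coupling *\<^sub>R T x)"
        by (rule arg_cong[where f = "(\<bullet>) (T x)"])
      then have "T x \<bullet> drift x = T x \<bullet> ?err + \<sigma> * (T x \<bullet> x) + coupling * (T x \<bullet> T x)"
        unfolding inner_add_right[of "T x" "?err + \<sigma> *\<^sub>R x"] inner_add_right[of "T x" ?err]
          inner_scaleR_right .
      ultimately show ?thesis by (simp add: inner_commute)
    qed
  qed (use \<sigma> p0 in auto)
qed

text \<open>\<open>exp (2 * \<sigma> * ln r)\<close> is \<open>r\<close> to the power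
  \<open>2 * \<sigma>\<close>. The derivative of its product with Q has the sign of
  \<open>r Q' + 2 \<sigma> r' Q\<close>, which is at least \<open>2 \<sigma> Q (1 + r')\<close> and
  so nonnegative by \<open>r' \<ge> -1\<close>.\<close>

lemma quadratic_growth:
  assumes sol: "solution_on lam E {0..b} z" and b: "b \<ge> 0"
    and T: "bounded_linear T" "\<And>x y. T x \<bullet> y = x \<bullet> T y" and \<sigma>: "\<sigma> \<ge> 0"
    and drift: "\<And>t. t \<in> {0..b} \<Longrightarrow>
      \<sigma> * (dev (z t) \<bullet> T (dev (z t))) \<le> T (dev (z t)) \<bullet> drift (dev (z t))"
    and start: "dev (z 0) \<bullet> T (dev (z 0)) > 0"
  shows "(dev (z 0) \<bullet> T (dev (z 0))) * exp (2 * \<sigma> * ln (mean (z 0)))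
     \<le> (dev (z b) \<bullet> T (dev (z b))) * exp (2 * \<sigma> * ln (mean (z b)))"
proof -
  let ?Q = "\<lambda>t. dev (z t) \<bullet> T (dev (z t))"
  let ?Q' = "\<lambda>t. 2 * (T (dev (z t)) \<bullet> drift (dev (z t))) / mean (z t)"
  have r: "mean (z t) > 0" if "t \<in> {0..b}" for t
    using mean_pos[OF solution_onD(1)[OF sol that]] .
  have Q': "(?Q has_real_derivative ?Q' t) (at t within {0..b})" if "t \<in> {0..b}" for t
    using quadratic_solution_deriv[OF sol that T] .
  have Q'_lower: "2 * \<sigma> * ?Q t \<le> ?Q' t * mean (z t)" if "t \<in> {0..b}" for t
    using drift[OF that] r[OF that] by simp
  \<comment> \<open>Positivity of Q must come first, since the final estimate multiplies
    \<open>1 + r' \<ge> 0\<close> by Q. It persists because Q cannot decrease while it is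
    nonnegative.\<close>
  have pos: "?Q t > 0" if t: "t \<in> {0..b}" for t
  proof -
    have "- ?Q t < 0"
    proof (rule stays_below[where a = 0 and b = t and f' = "\<lambda>t. - ?Q' t"])
      show "((\<lambda>t. - ?Q t) has_real_derivative - ?Q' s) (at s within {0..t})" if "s \<in> {0..t}" for s
        using that t by (intro DERIV_minus DERIV_subset[OF Q']) auto
      show "- ?Q' s \<le> 0" if "s \<in> {0..t}" "- ?Q s \<le> 0" for s
      proof -
        have s: "s \<in> {0..b}" using that t by auto
        have "0 \<le> 2 * \<sigma> * ?Q s" using that(2) \<sigma> by simp
        also note Q'_lower[OF s]
        finally show ?thesis using r[OF s] by (simp add: zero_le_mult_iff)
      qed
    qed (use start t in auto)
    then show ?thesis by simp
  qed
  have "- (?Q b * exp (2 * \<sigma> * ln (mean (z b)))) \<le> - (?Q 0 * exp (2 * \<sigma> * ln (mean (z 0))))"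
  proof (rule has_real_derivative_nonpos_imp_le[OF b])
    fix t assume t: "t \<in> {0..b}"
    let ?r = "mean (z t)" and ?r' = "mean (field (z t))"
    let ?e = "exp (2 * \<sigma> * ln ?r)"
    have ln: "((\<lambda>t. 2 * \<sigma> * ln (mean (z t))) has_real_derivative 2 * \<sigma> * (?r' / ?r)) (at t within {0..b})"
      using r[OF t] by (auto intro!: derivative_eq_intros mean_solution_deriv[OF sol t])
    show "((\<lambda>t. - (?Q t * exp (2 * \<sigma> * ln (mean (z t))))) has_real_derivative
        - (?Q' t * ?e + ?e * (2 * \<sigma> * (?r' / ?r)) * ?Q t)) (at t within {0..b})"
      by (intro DERIV_minus DERIV_mult Q'[OF t] DERIV_chain2[OF DERIV_exp ln])
    have "0 \<le> 2 * \<sigma> * ?Q t * (1 + ?r')"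
      using \<sigma> pos[OF t] mean_field_bounds(1)[OF solution_onD(1)[OF sol t]] by simp
    also have "\<dots> \<le> ?Q' t * ?r + 2 * \<sigma> * ?r' * ?Q t"
      using Q'_lower[OF t] by (simp add: algebra_simps)
    also have "\<dots> = (?Q' t + 2 * \<sigma> * (?r' / ?r) * ?Q t) * ?r"
      using r[OF t] by (simp add: distrib_right)
    finally have "0 \<le> ?Q' t + 2 * \<sigma> * (?r' / ?r) * ?Q t"
      using r[OF t] by (simp add: zero_le_mult_iff)
    then have "0 \<le> ?e * (?Q' t + 2 * \<sigma> * (?r' / ?r) * ?Q t)" by (intro mult_nonneg_nonneg) auto
    also have "\<dots> = ?Q' t * ?e + ?e * (2 * \<sigma> * (?r' / ?r)) * ?Q t"
      by (simp only: distrib_left ac_simps)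
    finally show "- (?Q' t * ?e + ?e * (2 * \<sigma> * (?r' / ?r)) * ?Q t) \<le> 0" by simp
  qed
  then show ?thesis by simp
qed

lemma mean_upper_bound:
  assumes sol: "solution_on lam E {0..b} z" and b: "b \<ge> 0"
    and le: "\<And>t. t \<in> {0..b} \<Longrightarrow> mean (field (z t)) \<le> a"
  shows "mean (z b) \<le> mean (z 0) + a * b"
proof -
  have "mean (z b) - a * b \<le> mean (z 0) - a * 0"
    by (rule has_real_derivative_nonpos_imp_le[OF b, of _ "\<lambda>t. mean (field (z t)) - a"])
      (use le in \<open>auto intro!: derivative_eq_intros mean_solution_deriv[OF sol]\<close>)
  then show ?thesis by simp
qed

text \<open>By contradiction: if all solutions from the \<open>\<delta>\<close>-cone stayed in the
  \<open>u\<close>-cone, one started in the unstable direction would keep its mean above a positive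
  \<open>r1\<close> and its coordinates below 3/2. Such a solution exists for all time, yet its mean
  falls with slope at most \<open>growth / 2 < 0\<close>.\<close>

lemma diagonal_unstable:
  assumes unstable: "growth + coupling * gap\<^sup>2 < 0"
  shows "diagonal_locally_unstable lam E"
proof -
  obtain T \<sigma> \<rho> M e where T: "bounded_linear T" "\<And>x y. T x \<bullet> y = x \<bullet> T y"
    and \<sigma>: "\<sigma> > 0" and \<rho>: "0 < \<rho>" "\<rho> \<le> 1/2"
    and drift: "\<And>x. mean x = 0 \<Longrightarrow> norm x \<le> \<rho> \<Longrightarrow> \<sigma> * (x \<bullet> T x) \<le> T x \<bullet> drift x"
    and M: "\<And>x. x \<bullet> T x \<le> M * (norm x)\<^sup>2" "M > 0" and e: "mean e = 0" "e \<bullet> T e > 0"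
    and decreasing: "\<And>x. norm x \<le> \<rho> \<Longrightarrow> mean (field (1 + x)) \<le> growth / 2"
    using unstable_drift[OF unstable] by blast
  interpret T: bounded_linear T by (rule T)
  have growth_neg: "growth < 0"
  proof -
    have "0 \<le> coupling * gap\<^sup>2" using coupling_pos by simp
    then show ?thesis using unstable by linarith
  qed
  define u where "u = \<rho> / real CARD('n)"
  have u: "u > 0" using \<rho> by (simp add: u_def)
  have cone: "norm (dev x) \<le> \<rho>" if "x \<in> diag_cone u" for x :: "real^'n"
    using that norm_le_l1norm[of "dev x"] by (simp add: diag_cone_iff u_def)
  show ?thesis
    unfolding diagonal_locally_unstable_def
  proof (rule exI[of _ u], intro conjI u allI impI, rule ccontr)
    fix \<delta> :: real assume \<delta>: "\<delta> > 0"
    assume "\<not> (\<exists>T>0. \<exists>z. solution_on lam E {0..<T} z \<and> z 0 \<in> diag_cone \<delta> \<and>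
              (\<exists>t\<in>{0..<T}. z t \<notin> diag_cone u))"
    then have stays: "z t \<in> diag_cone u"
      if "solution_on lam E {0..<T} z" "z 0 \<in> diag_cone \<delta>" "t \<in> {0..<T}" for z T t
      using that by (meson atLeastLessThan_iff order_le_less_trans)
    \<comment> \<open>The first entry of the minimum puts \<open>1 + \<tau> *\<^sub>R e\<close> into
      the \<open>\<delta>\<close>-cone, the second keeps its coordinates between 1/2 and
      3/2.\<close>
    define \<tau> where "\<tau> = min (real CARD('n) * \<delta>) (1/2) / (l1norm e + 1)"
    have l1e: "l1norm e \<ge> 0" by (simp add: l1norm_def sum_nonneg)
    have \<tau>: "\<tau> > 0" using \<delta> l1e by (simp add: \<tau>_def)
    have "\<tau> * l1norm e \<le> \<tau> * (l1norm e + 1)" using \<tau> by simp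
    also have "\<dots> = min (real CARD('n) * \<delta>) (1/2)" using l1e by (simp add: \<tau>_def)
    finally have \<tau>_le: "\<tau> * l1norm e \<le> real CARD('n) * \<delta>" "\<tau> * l1norm e \<le> 1/2" by auto
    define z0 where "z0 = 1 + \<tau> *\<^sub>R e"
    have z0_nth: "1/2 \<le> z0 $ i" "z0 $ i \<le> 3/2" for i
    proof -
      have "\<bar>\<tau> * e $ i\<bar> \<le> norm (\<tau> *\<^sub>R e)"
        using component_le_norm_cart[of "\<tau> *\<^sub>R e" i] by simp
      also have "\<dots> \<le> \<bar>\<tau>\<bar> * l1norm e"
        using norm_le_l1norm[of "\<tau> *\<^sub>R e"] by (simp only: l1norm_scaleR)
      also have "\<dots> \<le> 1/2" using \<tau> \<tau>_le(2) by simp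
      finally show "1/2 \<le> z0 $ i" "z0 $ i \<le> 3/2" by (auto simp: z0_def abs_le_iff)
    qed
    have "0 < z0 $ i" for i using z0_nth(1)[of i] by linarith
    then have z0H: "z0 \<in> H" by (simp add: H_def)
    have mean0: "mean z0 = 1" by (simp add: z0_def mean_linear_simps e)
    have dev0: "dev z0 = \<tau> *\<^sub>R e" using mean0 by (simp add: dev_def z0_def)
    have cone0: "z0 \<in> diag_cone \<delta>"
      using z0H \<tau>_le(1) \<tau> by (simp add: diag_cone_iff dev0 l1norm_scaleR)
    define Q0 where "Q0 = dev z0 \<bullet> T (dev z0)"
    have Q0: "Q0 > 0" using e(2) \<tau> by (simp add: Q0_def dev0 T.scaleR)
    \<comment> \<open>The solution of
      \<open>M * \<rho>\<^sup>2 * r powr (2 * \<sigma>) = Q0\<close>. As Q is at most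
      \<open>M * \<rho>\<^sup>2\<close> near the diagonal and the initial mean is 1, monotonicity
      keeps the mean above this value.\<close>
    define r1 where "r1 = exp (ln (Q0 / (M * \<rho>\<^sup>2)) / (2 * \<sigma>))"
    have bounds: "r1 \<le> mean (z b)" "mean (z b) \<le> 1 + growth / 2 * b"
      if sol: "solution_on lam E {0..b} z" and b: "b \<ge> 0" and z0: "z 0 = z0"
        and small: "\<And>t. t \<in> {0..b} \<Longrightarrow> norm (dev (z t)) \<le> \<rho>" for z b
    proof -
      have H: "z t \<in> H" if "t \<in> {0..b}" for t using solution_onD(1)[OF sol that] .
      have "mean (field (z t)) \<le> growth / 2" if "t \<in> {0..b}" for t
        using decreasing[OF small[OF that]] field_one_plus_dev[OF H[OF that]] by simp
      from mean_upper_bound[OF sol b this] show "mean (z b) \<le> 1 + growth / 2 * b"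
        by (simp add: z0 mean0)
      have r: "mean (z b) > 0" using mean_pos H b by auto
      have "Q0 * exp (2 * \<sigma> * ln 1) \<le> (dev (z b) \<bullet> T (dev (z b))) * exp (2 * \<sigma> * ln (mean (z b)))"
        using quadratic_growth[OF sol b T less_imp_le[OF \<sigma>] drift[OF mean_dev[OF H] small]] Q0
        by (simp add: z0 mean0 Q0_def)
      also have "\<dots> \<le> (M * \<rho>\<^sup>2) * exp (2 * \<sigma> * ln (mean (z b)))"
      proof (rule mult_right_mono)
        have "M * (norm (dev (z b)))\<^sup>2 \<le> M * \<rho>\<^sup>2"
          using small[of b] b M(2) by (intro mult_left_mono power_mono) auto
        with M(1)[of "dev (z b)"] show "dev (z b) \<bullet> T (dev (z b)) \<le> M * \<rho>\<^sup>2" by linarith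
      qed simp
      finally have "Q0 / (M * \<rho>\<^sup>2) \<le> exp (2 * \<sigma> * ln (mean (z b)))"
        using M(2) \<rho>(1) by (simp add: pos_divide_le_eq mult.commute)
      then have "ln (Q0 / (M * \<rho>\<^sup>2)) \<le> ln (exp (2 * \<sigma> * ln (mean (z b))))"
        using Q0 M(2) \<rho>(1) by (intro ln_le_cancel_iff[THEN iffD2]) auto
      then have "ln (Q0 / (M * \<rho>\<^sup>2)) \<le> 2 * \<sigma> * ln (mean (z b))" by simp
      then have "ln (Q0 / (M * \<rho>\<^sup>2)) / (2 * \<sigma>) \<le> ln (mean (z b))"
        using \<sigma> by (simp add: pos_divide_le_eq mult.commute)
      then have "r1 \<le> exp (ln (mean (z b)))" by (simp add: r1_def)
      then show "r1 \<le> mean (z b)" using r by simp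
    qed
    \<comment> \<open>The a priori bounds confine all coordinates to the range from
      \<open>r1 / 2\<close> to 3/2. The open box with sides from \<open>a\<close> to 2 contains this
      region, and its closure lies in \<open>H\<close>.\<close>
    define a where "a = min r1 1 / 4"
    have "r1 > 0" by (simp add: r1_def)
    then have a: "a > 0" "a \<le> 1/4" "a < r1 / 2" by (auto simp: a_def min_def)
    define S U where "S = cbox (\<chi> i. a) ((\<chi> i. 2)::real^'n)" and "U = box (\<chi> i. a) ((\<chi> i. 2)::real^'n)"
    have SH: "S \<subseteq> H"
      using less_le_trans[OF a(1)] by (auto simp: S_def H_def mem_box_cart)
    have US: "U \<subseteq> S" by (simp add: U_def S_def box_subset_cbox)
    have inU: "x \<in> U" if "\<And>i. a < x $ i" "\<And>i. x $ i \<le> 3/2" for x :: "real^'n"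
      using that(1) le_less_trans[OF that(2)] by (auto simp: U_def mem_box_cart)
    have "a < z0 $ i" for i using z0_nth(1)[of i] a(2) by linarith
    then have z0U: "z0 \<in> U" using z0_nth(2) by (rule inU)
    obtain L where L: "L-lipschitz_on S field"
      using field_lipschitz[OF _ SH] compact_cbox unfolding S_def by blast
    have "compact S" "convex S" "z0 \<in> S" using z0U US by (auto simp: S_def)
    from lipschitz_on_compact_ode_solution[OF this L]
    obtain x where x: "x 0 = z0" "continuous_on {0..} x"
      "\<And>t. t \<ge> 0 \<Longrightarrow> x t \<in> S \<Longrightarrow> (x has_vector_derivative field (x t)) (at t within {0..})"
      by blast
    have sol: "solution_on lam E {0..<b} x" if "\<And>t. t \<in> {0..<b} \<Longrightarrow> x t \<in> U" for b
      unfolding solution_on_def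
    proof (intro ballI conjI)
      fix t assume t: "t \<in> {0..<b}"
      then have tS: "x t \<in> S" using that US by blast
      then show "x t \<in> H" using SH by blast
      show "(x has_vector_derivative F lam E (phi E (x t))) (at t within {0..<b})"
        unfolding field_def[symmetric]
        by (rule has_vector_derivative_within_subset[OF x(3)]) (use t tS in auto)
    qed
    have x_bounds: "norm (dev (x t)) \<le> \<rho>" "r1 \<le> mean (x t)" "mean (x t) \<le> 1 + growth / 2 * t"
      if inb: "\<And>t. t \<in> {0..<b} \<Longrightarrow> x t \<in> U" and t: "t \<in> {0..<b}" for b t
    proof -
      have small: "norm (dev (x s)) \<le> \<rho>" if "s \<in> {0..<b}" for s
      proof -
        have "x 0 \<in> diag_cone \<delta>" using cone0 x(1) by simp
        from stays[OF sol[OF inb] this that] show ?thesis by (rule cone)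
      qed
      have "solution_on lam E {0..t} x"
        using sol[OF inb] by (rule solution_on_subset) (use t in auto)
      then have "r1 \<le> mean (x t) \<and> mean (x t) \<le> 1 + growth / 2 * t"
        using bounds[of t x] x(1) small t by auto
      then show "norm (dev (x t)) \<le> \<rho>" "r1 \<le> mean (x t)" "mean (x t) \<le> 1 + growth / 2 * t"
        using small[OF t] by auto
    qed
    \<comment> \<open>At a first exit time the closed bounds on the coordinates pass to the limit
      and put the point back into the open box.\<close>
    have stayU: "x b \<in> U" if b: "b \<ge> 0" for b
    proof (rule ccontr)
      assume "x b \<notin> U"
      moreover have "continuous_on {0..b} x" using x(2) by (rule continuous_on_subset) auto
      moreover have "open U" by (simp add: U_def open_box)
      ultimately obtain t where t: "0 < t" "t \<le> b" "x t \<notin> U" "\<And>s. s \<in> {0..<t} \<Longrightarrow> x s \<in> U"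
        using first_exit[of 0 b x U] z0U x(1) b by metis
      have ev: "\<forall>\<^sub>F s in at_left t. s \<in> {0..<t}"
        using t(1) by (auto simp: eventually_at_left intro!: exI[of _ 0])
      have nth: "r1 / 2 \<le> x s $ i" "x s $ i \<le> 3/2" if s: "s \<in> {0..<t}" for s i
      proof -
        note xb = x_bounds[OF t(4) s]
        have H: "x s \<in> H" using t(4)[OF s] US SH by blast
        have "norm (dev (x s)) \<le> 1/2" using xb(1) \<rho>(2) by linarith
        note nb = nth_lower_bound[OF H this, of i]
        have "growth / 2 * s \<le> 0" using growth_neg s by (simp add: mult_nonpos_nonneg)
        then have "mean (x s) \<le> 1" using xb(3) by linarith
        then show "r1 / 2 \<le> x s $ i" "x s $ i \<le> 3/2" using nb xb(2) by linarith+
      qed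
      have "continuous_on {0..t} x" using x(2) by (rule continuous_on_subset) auto
      then have "(x \<longlongrightarrow> x t) (at t within {0..t})"
        using t(1) by (simp add: continuous_on)
      then have lim: "(x \<longlongrightarrow> x t) (at_left t)"
        using at_within_Icc_at_left[OF t(1)] by simp
      have "r1 / 2 \<le> x t $ i" for i
        by (rule tendsto_lowerbound[OF tendsto_vec_nth[OF lim] eventually_mono[OF ev nth(1)]]) auto
      moreover have "x t $ i \<le> 3/2" for i
        by (rule tendsto_upperbound[OF tendsto_vec_nth[OF lim] eventually_mono[OF ev nth(2)]]) auto
      ultimately have "x t \<in> U" using less_le_trans[OF a(3)] by (intro inU) auto
      with t(3) show False by blast
    qed
    \<comment> \<open>The time at which the upper bound \<open>1 + growth / 2 * t\<close> vanishes.
      The bounds are then taken on the interval up to \<open>b + 1\<close>, because its right end is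
      excluded.\<close>
    define b where "b = - 2 / growth"
    have b: "b > 0" using growth_neg by (simp add: b_def)
    have "mean (x b) \<le> 1 + growth / 2 * b"
      using x_bounds(3)[of "b + 1" b] stayU b by auto
    also have "\<dots> = 0" using growth_neg by (simp add: b_def)
    finally have "mean (x b) \<le> 0" .
    moreover have "x b \<in> H" using stayU[of b] b US SH by auto
    ultimately show False using mean_pos[of "x b"] by linarith
  qed
qed

end

theorem theorem7:
  fixes lam gap :: real
    and E :: "'n::finite \<Rightarrow> 'n \<Rightarrow> bool"
    and V :: nat
  assumes lam_pos: "lam > 0"
    and K_ge_2: "CARD('n) \<ge> 2"
    and undirected: "symp E"
    and loopless: "irreflp E"
    and connected: "\<And>i j. E\<^sup>*\<^sup>* i j"
    and regular: "\<And>i. card (nbhd E i) = V"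
    and gap: "gap = spectral_gap (nbhd_matrix E)"
  shows "(lam > exp (-1) / real V * (1 - gap\<^sup>2 / (real V)\<^sup>2) \<longrightarrow>
            (\<exists>u>0.
               (\<forall>z. solution_on lam E {0..} z \<and> z 0 \<in> diag_cone u \<longrightarrow>
                  ((\<lambda>t. phi E (z t)) \<longlongrightarrow> (\<chi> i. 1 / real V)) at_top) \<and>
               (\<forall>T z. finite_maximal_solution lam E T z \<and> z 0 \<in> diag_cone u \<longrightarrow>
                  ((\<lambda>t. phi E (z t)) \<longlongrightarrow> (\<chi> i. 1 / real V)) (at_left T))))
       \<and> (lam < exp (-1) / real V * (1 - gap\<^sup>2 / (real V)\<^sup>2) \<longrightarrow>
            diagonal_locally_unstable lam E)"
proof -
  interpret regular_graph E V lam
    using lam_pos K_ge_2 undirected regular by unfold_locales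
  \<comment> \<open>The distance of \<open>lam\<close> from the threshold is the number \<mu> of the
    outline.\<close>
  have "lam - exp (-1) / real V * (1 - gap\<^sup>2 / (real V)\<^sup>2)
      = growth + coupling * (spectral_gap (nbhd_matrix E))\<^sup>2"
    by (simp add: growth_def coupling_def gap power2_eq_square power3_eq_cube algebra_simps)
  then have "lam > exp (-1) / real V * (1 - gap\<^sup>2 / (real V)\<^sup>2) \<longleftrightarrow>
        growth + coupling * (spectral_gap (nbhd_matrix E))\<^sup>2 > 0"
    and "lam < exp (-1) / real V * (1 - gap\<^sup>2 / (real V)\<^sup>2) \<longleftrightarrow>
        growth + coupling * (spectral_gap (nbhd_matrix E))\<^sup>2 < 0"
    by linarith+
  then show ?thesis
    using phi_converges diagonal_unstable by metis
qed

end
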